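(* Let $r=1$ and use the cosine basis $\psi_0=1$, $\psi_j(x)=\sqrt2\cos(\pi jx)$, $j\ge1$, of $L_2(0,1)$ (so $c_0=\sup_j\sup_x|\psi_j(x)|=\sqrt2$). Let $\gamma>1$, $C>0$, and let $X_1,\dots,X_n$ be i.i.d. with density $p=1+\sum_{j\ge1}\beta_j\psi_j\in\mathcal P(\gamma,C)$. Let $m_n=\lfloor n^{1/(2\gamma+1)}\rfloor$, $k\asymp\sqrt n$, $m_k=\lfloor k^{1/(2\gamma+1)}\rfloor$, and define $\hat p(x)=1+\sum_{j=1}^{m_n}\hat\beta_j\psi_j(x)$ with $\hat\beta_j=n^{-1}\sum_{i=1}^n\psi_j(X_i)$, and for $z\in[0,1]^k$, $\hat p^*_z(x)=1+\sum_{j=1}^{m_k}\hat\beta^*_j\psi_j(x)$ with $\hat\beta^*_j=k^{-1}\sum_{i=1}^k\psi_j(z_i)$. Let $Z=(Z_1,\dots,Z_k)$ be drawn from the density on $[0,1]^k$ proportional to $\exp\big(-\alpha\,\xi(X,z)/(2\Delta)\big)$, where $\xi(X,z)=\|\hat p-\hat p^*_z\|_{\ell_2}$ and $\Delta=2c_0^2m_n/n$, and set $\hat p^*=\hat p^*_Z$. Then $$\int_0^1(p(x)-\hat p^*(x))^2dx=O_P\big(n^{-\gamma/(2\gamma+1)}\big).$$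
   Context: For $u\in L_2(0,1)$, $\|u\|_{\ell_2}=(\int_0^1|u(x)|^2dx)^{1/2}$. Sobolev class: for $\gamma>1/2$, $C>0$, $\mathcal B(\gamma,C)=\{\beta=(\beta_1,\beta_2,\dots):\sum_{j\ge1}\beta_j^2j^{2\gamma}\le C^2\}$ and $\mathcal P(\gamma,C)=\{p=1+\sum_{j\ge1}\beta_j\psi_j:\beta\in\mathcal B(\gamma,C)\}$ (densities on $[0,1]$). $a_n\asymp b_n$ means $a_n/b_n$ and $b_n/a_n$ are bounded for large $n$; $\alpha>0$ is fixed; $O_P$ refers to the joint law of $X$ and $Z$. *)

theory Defs
  imports "HOL-Probability.Probability" "HOL-Library.Landau_Symbols"
begin

definition psi :: "nat \<Rightarrow> real \<Rightarrow> real" where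
  "psi j x = (if j = 0 then 1 else sqrt 2 * cos (pi * real j * x))"

definition c0 :: real where "c0 = sqrt 2"

text \<open>Sobolev ellipsoid B(gamma,C); coefficients beta_1, beta_2, ... (beta 0 is unused).\<close>
definition sobolev_coeffs :: "real \<Rightarrow> real \<Rightarrow> (nat \<Rightarrow> real) set" where
  "sobolev_coeffs \<gamma> C = {\<beta>. summable (\<lambda>j. (\<beta> (Suc j))\<^sup>2 * real (Suc j) powr (2 * \<gamma>))
       \<and> (\<Sum>j. (\<beta> (Suc j))\<^sup>2 * real (Suc j) powr (2 * \<gamma>)) \<le> C\<^sup>2}"

definition sobolev_densities :: "real \<Rightarrow> real \<Rightarrow> (real \<Rightarrow> real) set" where
  "sobolev_densities \<gamma> C = {p. \<exists>\<beta>\<in>sobolev_coeffs \<gamma> C.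
       \<forall>x\<in>{0..1}. p x = 1 + (\<Sum>j. \<beta> (Suc j) * psi (Suc j) x) \<and> p x \<ge> 0}"

definition trunc_level :: "real \<Rightarrow> nat \<Rightarrow> nat" where
  "trunc_level \<gamma> n = nat \<lfloor>real n powr (1 / (2 * \<gamma> + 1))\<rfloor>"

definition proj_est :: "nat \<Rightarrow> nat \<Rightarrow> (nat \<Rightarrow> real) \<Rightarrow> real \<Rightarrow> real" where
  "proj_est m N x t = 1 + (\<Sum>j=1..m. ((\<Sum>i<N. psi j (x i)) / real N) * psi j t)"

definition p_hat :: "real \<Rightarrow> nat \<Rightarrow> (nat \<Rightarrow> real) \<Rightarrow> real \<Rightarrow> real" where
  "p_hat \<gamma> n x = proj_est (trunc_level \<gamma> n) n x"

definition p_star :: "real \<Rightarrow> nat \<Rightarrow> (nat \<Rightarrow> real) \<Rightarrow> real \<Rightarrow> real" where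
  "p_star \<gamma> k z = proj_est (trunc_level \<gamma> k) k z"

definition xi :: "real \<Rightarrow> nat \<Rightarrow> nat \<Rightarrow> (nat \<Rightarrow> real) \<Rightarrow> (nat \<Rightarrow> real) \<Rightarrow> real" where
  "xi \<gamma> n k x z = sqrt (LINT t:{0..1}|lborel. (p_hat \<gamma> n x t - p_star \<gamma> k z t)\<^sup>2)"

definition Delta :: "real \<Rightarrow> nat \<Rightarrow> real" where
  "Delta \<gamma> n = 2 * c0\<^sup>2 * real (trunc_level \<gamma> n) / real n"

definition weight :: "real \<Rightarrow> real \<Rightarrow> nat \<Rightarrow> nat \<Rightarrow> (nat \<Rightarrow> real) \<Rightarrow> (nat \<Rightarrow> real) \<Rightarrow> ennreal" where
  "weight \<alpha> \<gamma> n k x z = (\<Prod>i<k. indicator {0..1} (z i)) *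
      ennreal (exp (- \<alpha> * xi \<gamma> n k x z / (2 * Delta \<gamma> n)))"

definition normaliser :: "real \<Rightarrow> real \<Rightarrow> nat \<Rightarrow> nat \<Rightarrow> (nat \<Rightarrow> real) \<Rightarrow> ennreal" where
  "normaliser \<alpha> \<gamma> n k x = (\<integral>\<^sup>+ z. weight \<alpha> \<gamma> n k x z \<partial>(PiM {..<k} (\<lambda>_. lborel)))"

definition joint_law :: "real \<Rightarrow> real \<Rightarrow> (real \<Rightarrow> real) \<Rightarrow> nat \<Rightarrow> nat
    \<Rightarrow> ((nat \<Rightarrow> real) \<times> (nat \<Rightarrow> real)) measure" where
  "joint_law \<alpha> \<gamma> p n k = density (PiM {..<n} (\<lambda>_. lborel) \<Otimes>\<^sub>M PiM {..<k} (\<lambda>_. lborel))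
     (\<lambda>(x, z). (\<Prod>i<n. ennreal (indicator {0..1} (x i) * p (x i)))
                 * weight \<alpha> \<gamma> n k x z / normaliser \<alpha> \<gamma> n k x)"

end

theory Submission
  imports Defs "HOL-Real_Asymp.Real_Asymp"
begin

text \<open>
  Write \<open>a = \<gamma> / (2 * \<gamma> + 1)\<close> and \<open>r = n powr (- a)\<close>. The projection estimator from \<open>N\<close> observations has
  integrated squared risk of order \<open>N powr (- 2 * a)\<close>. With \<open>N = n\<close> and Markov's inequality,
  \<open>p_hat\<close> is within squared distance \<open>r\<close> of \<open>p\<close> with probability tending to 1. With \<open>N = k \<approx> sqrt n\<close>, the
  probabilistic method produces a single \<open>z\<close> in the cube whose estimator is within squared distance
  of order \<open>r\<close> of \<open>p\<close>, and the same holds on a box of side \<open>1 / n\<close> around \<open>z\<close>, of volume at least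
  \<open>exp (- k * ln n)\<close>.

  Against this box, outputs whose score exceeds that of the box by a multiple of \<open>sqrt r\<close> carry conditional mass
  at most \<open>exp (k * ln n - c * sqrt r / Delta)\<close>. Here \<open>sqrt r / Delta\<close> is of order \<open>n powr (3 / 2 * a)\<close>,
  which beats \<open>k * ln n\<close> because \<open>3 / 2 * a > 1 / 2\<close>, that is, because \<open>\<gamma> > 1\<close>.
\<close>

subsection \<open>The cosine basis\<close>

lemma square_diff_le: "(a - b)\<^sup>2 \<le> 2 * a\<^sup>2 + 2 * b\<^sup>2" for a b :: real
  using zero_le_power2[of "a + b"] unfolding power2_sum power2_diff by linarith

text \<open>As a restricted space this is a probability measure, so bounded measurable functions are
  integrable at once and integrands carry no indicator.\<close>

definition unit_leb :: "real measure" where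
  "unit_leb = restrict_space lborel {0..1}"

lemma set_integral_unit: "(LINT t:{0..1}|lborel. f t) = (LINT t|unit_leb. f t)"
  for f :: "real \<Rightarrow> real"
  by (simp add: unit_leb_def integral_restrict_space set_lebesgue_integral_def)

lemma space_unit_leb [simp]: "space unit_leb = {0..1}"
  by (simp add: unit_leb_def space_restrict_space)

lemma prob_space_unit_leb: "prob_space unit_leb"
  by (rule prob_spaceI) (simp add: unit_leb_def space_restrict_space emeasure_restrict_space)

interpretation unit: prob_space unit_leb
  by (rule prob_space_unit_leb)

lemma measurable_unit_leb: "f \<in> borel_measurable borel \<Longrightarrow> f \<in> borel_measurable unit_leb"
  by (simp add: unit_leb_def measurable_restrict_space1)

lemma integrable_unit_bounded:
  fixes f :: "real \<Rightarrow> real"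
  assumes "f \<in> borel_measurable borel" "\<And>t. t \<in> {0..1} \<Longrightarrow> \<bar>f t\<bar> \<le> B"
  shows "integrable unit_leb f"
  by (rule unit.integrable_const_bound[of _ B]) (use assms in \<open>auto simp: measurable_unit_leb\<close>)

text \<open>Pointwise (u - v)^2 \<le> 2 u^2 + 2 v^2, integrated. This stands in for Minkowski's
  inequality, so all distances can be handled as squares at the price of factors 2.\<close>

lemma integral_square_triangle:
  fixes f g h :: "real \<Rightarrow> real"
  assumes "integrable unit_leb (\<lambda>t. (f t - g t)\<^sup>2)" "integrable unit_leb (\<lambda>t. (g t - h t)\<^sup>2)"
  shows "(LINT t|unit_leb. (f t - h t)\<^sup>2)
    \<le> 2 * (LINT t|unit_leb. (f t - g t)\<^sup>2) + 2 * (LINT t|unit_leb. (g t - h t)\<^sup>2)"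
proof -
  have "(LINT t|unit_leb. (f t - h t)\<^sup>2) \<le> (LINT t|unit_leb. 2 * (f t - g t)\<^sup>2 + 2 * (g t - h t)\<^sup>2)"
  proof (rule integral_mono')
    show "(f t - h t)\<^sup>2 \<le> 2 * (f t - g t)\<^sup>2 + 2 * (g t - h t)\<^sup>2" for t
      using square_diff_le[of "f t - g t" "h t - g t"] by (simp add: power2_commute[of "g t"])
  qed (use assms in auto)
  then show ?thesis using assms by simp
qed

lemma integral_unit_FTC:
  fixes f F :: "real \<Rightarrow> real"
  assumes "\<And>x. (F has_real_derivative f x) (at x)" "\<And>x. isCont f x"
  shows "(LINT t|unit_leb. f t) = F 1 - F 0"
proof -
  have "(\<integral>x. f x * indicator {0..1} x \<partial>lborel) = F 1 - F 0"
    by (rule integral_FTC_Icc_real) (use assms in auto)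
  then show ?thesis
    unfolding set_integral_unit[symmetric] set_lebesgue_integral_def by (simp add: mult.commute)
qed

lemma psi_0 [simp]: "psi 0 x = 1"
  by (simp add: psi_def)

lemma psi_measurable [measurable]: "psi j \<in> borel_measurable borel"
proof (cases "j = 0")
  case False
  then have "psi j = (\<lambda>x. sqrt 2 * cos (pi * real j * x))" by (auto simp: psi_def)
  then show ?thesis by simp
qed (simp add: psi_def[abs_def])

lemma abs_psi_le: "\<bar>psi j x\<bar> \<le> sqrt 2"
proof (cases "j = 0")
  case False
  have "sqrt 2 * \<bar>cos (pi * real j * x)\<bar> \<le> sqrt 2 * 1"
    by (intro mult_left_mono) auto
  then show ?thesis using False by (simp add: psi_def abs_mult)
qed simp

text \<open>The difference of cosines is a product of two sines: one is bounded by 1, the other by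
  its argument.\<close>

lemma psi_lipschitz: "\<bar>psi j x - psi j y\<bar> \<le> sqrt 2 * pi * real j * \<bar>x - y\<bar>"
proof (cases "j = 0")
  case False
  have "cos (pi * real j * x) - cos (pi * real j * y) =
      2 * sin ((pi * real j * x + pi * real j * y) / 2) * sin ((pi * real j * y - pi * real j * x) / 2)"
    by (rule cos_diff_cos)
  then have "\<bar>cos (pi * real j * x) - cos (pi * real j * y)\<bar> =
      2 * (\<bar>sin ((pi * real j * x + pi * real j * y) / 2)\<bar> * \<bar>sin ((pi * real j * y - pi * real j * x) / 2)\<bar>)"
    by (simp add: abs_mult)
  also have "\<dots> \<le> 2 * (1 * \<bar>(pi * real j * y - pi * real j * x) / 2\<bar>)"
    by (intro mult_left_mono mult_mono abs_sin_le_one abs_sin_x_le_abs_x) auto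
  also have "\<dots> = pi * real j * \<bar>x - y\<bar>"
    by (simp add: abs_mult abs_minus_commute flip: right_diff_distrib)
  finally have "sqrt 2 * \<bar>cos (pi * real j * x) - cos (pi * real j * y)\<bar> \<le> sqrt 2 * (pi * real j * \<bar>x - y\<bar>)"
    by (intro mult_left_mono) auto
  then show ?thesis using False
    by (simp add: psi_def abs_mult mult.assoc flip: right_diff_distrib)
qed simp

text \<open>For nonzero \<open>a\<close> the antiderivative is a multiple of sin(pi a t), which
  vanishes at both endpoints. The frequency is an integer because differences of indices may be
  negative.\<close>

lemma integral_cos_int:
  "(LINT t|unit_leb. cos (pi * real_of_int a * t)) = (if a = 0 then 1 else 0)"
proof (cases "a = 0")
  case True
  then show ?thesis using unit.prob_space by simp
next
  case False
  have "(LINT t|unit_leb. cos (pi * real_of_int a * t)) =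
      sin (pi * real_of_int a * 1) / (pi * real_of_int a) - sin (pi * real_of_int a * 0) / (pi * real_of_int a)"
    by (rule integral_unit_FTC) (use False in \<open>auto intro!: derivative_eq_intros\<close>)
  then show ?thesis using False
    by (metis (no_types, lifting) diff_zero div_0 mult.commute mult.right_neutral mult_zero_right sin_zero sin_npi_int)
qed

lemma psi_orthonormal:
  "(LINT t|unit_leb. psi i t * psi j t) = (if i = j then 1 else 0)"
proof -
  \<comment> \<open>\<open>s\<close> is the normalising factor that makes psi_j = s_j cos(pi j t)
    hold for every j, including 0.\<close>
  define s where "s j = (if j = 0 then 1 else sqrt 2)" for j :: nat
  have int: "integrable unit_leb (\<lambda>t. cos (pi * real_of_int a * t))" for a
    by (rule integrable_unit_bounded[of _ 1]) auto
  have "psi i t * psi j t = s i * s j / 2 *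
      (cos (pi * real_of_int (int i - int j) * t) + cos (pi * real_of_int (int i + int j) * t))" for t
  proof -
    have "psi i t * psi j t = s i * s j * (cos (pi * real i * t) * cos (pi * real j * t))"
      by (auto simp: psi_def s_def)
    then show ?thesis by (simp add: cos_times_cos algebra_simps)
  qed
  then have "(LINT t|unit_leb. psi i t * psi j t) = s i * s j / 2 *
      ((LINT t|unit_leb. cos (pi * real_of_int (int i - int j) * t))
       + (LINT t|unit_leb. cos (pi * real_of_int (int i + int j) * t)))"
    by (simp only: integral_mult_right_zero Bochner_Integration.integral_add[OF int int])
  \<comment> \<open>The cosine of the sum frequency contributes only for i = j = 0; there the second
    integral makes up for s_0 being 1 instead of sqrt 2.\<close>
  moreover have "int i + int j = 0 \<longleftrightarrow> i = 0 \<and> j = 0" by auto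
  ultimately show ?thesis unfolding integral_cos_int by (cases "i = j"; cases "i = 0") (simp_all add: s_def)
qed

lemma integrable_psi_mult: "integrable unit_leb (\<lambda>t. psi i t * psi j t)"
  by (rule integrable_unit_bounded[of _ "sqrt 2 * sqrt 2"])
    (auto simp: abs_mult simp del: real_sqrt_mult_self intro!: mult_mono abs_psi_le)

lemma abs_cosine_sum_le: "\<bar>\<Sum>j\<in>J. a j * psi j t\<bar> \<le> (\<Sum>j\<in>J. \<bar>a j\<bar>) * sqrt 2"
proof -
  have "\<bar>\<Sum>j\<in>J. a j * psi j t\<bar> \<le> (\<Sum>j\<in>J. \<bar>a j\<bar> * \<bar>psi j t\<bar>)"
    by (metis (no_types, lifting) abs_mult sum.cong sum_abs)
  also have "\<dots> \<le> (\<Sum>j\<in>J. \<bar>a j\<bar> * sqrt 2)"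
    by (intro sum_mono mult_left_mono abs_psi_le) auto
  finally show ?thesis by (simp add: sum_distrib_right)
qed

lemma integral_cosine_sum_mult_psi:
  assumes "finite J"
  shows "(LINT t|unit_leb. (\<Sum>j\<in>J. a j * psi j t) * psi i t) = (if i \<in> J then a i else 0)"
proof -
  have "(LINT t|unit_leb. (\<Sum>j\<in>J. a j * psi j t) * psi i t)
      = (LINT t|unit_leb. (\<Sum>j\<in>J. a j * (psi j t * psi i t)))"
    by (simp add: sum_distrib_right mult.assoc)
  also have "\<dots> = (\<Sum>j\<in>J. a j * (if j = i then 1 else 0))"
    by (subst Bochner_Integration.integral_sum)
      (auto simp: psi_orthonormal intro!: integrable_mult_right integrable_psi_mult)
  also have "\<dots> = (if i \<in> J then a i else 0)" 
    using assms by (simp add: if_distrib[of "(*) _"] cong: if_cong)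
  finally show ?thesis .
qed

text \<open>Parseval for finite cosine sums: expand one factor of the square and read off the
  coefficients of the other by orthonormality.\<close>

lemma integral_cosine_sum_square:
  assumes "finite J"
  shows "(LINT t|unit_leb. (\<Sum>j\<in>J. a j * psi j t)\<^sup>2) = (\<Sum>j\<in>J. (a j)\<^sup>2)"
proof -
  have int: "integrable unit_leb (\<lambda>t. a j * ((\<Sum>i\<in>J. a i * psi i t) * psi j t))" for j
  proof (intro integrable_mult_right integrable_unit_bounded)
    show "\<bar>(\<Sum>i\<in>J. a i * psi i t) * psi j t\<bar> \<le> (\<Sum>j\<in>J. \<bar>a j\<bar>) * sqrt 2 * sqrt 2" for t
      unfolding abs_mult by (intro mult_mono abs_psi_le abs_cosine_sum_le) (auto intro!: mult_nonneg_nonneg sum_nonneg)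
  qed auto
  have "(LINT t|unit_leb. (\<Sum>j\<in>J. a j * psi j t)\<^sup>2)
      = (LINT t|unit_leb. (\<Sum>j\<in>J. a j * ((\<Sum>i\<in>J. a i * psi i t) * psi j t)))"
    by (simp add: power2_eq_square sum_distrib_left mult_ac)
  also have "\<dots> = (\<Sum>j\<in>J. a j * (if j \<in> J then a j else 0))"
    by (subst Bochner_Integration.integral_sum[OF int]) (simp add: integral_cosine_sum_mult_psi[OF assms])
  finally show ?thesis by (simp add: power2_eq_square)
qed

section \<open>Projection estimators as finite cosine sums\<close>

definition emp_coeff :: "nat \<Rightarrow> (nat \<Rightarrow> real) \<Rightarrow> nat \<Rightarrow> real" where
  "emp_coeff N x j = (if j = 0 then 1 else (\<Sum>i<N. psi j (x i)) / real N)"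

text \<open>The coefficient at index 0 is the fixed leading 1, so the estimator is one sum over
  \<open>{..m}\<close> to which Parseval applies directly.\<close>

lemma proj_est_eq: "proj_est m N x t = (\<Sum>j\<le>m. emp_coeff N x j * psi j t)"
proof -
  have "{..m} = insert 0 {1..m}" by auto
  then show ?thesis by (simp add: proj_est_def emp_coeff_def)
qed

lemma proj_est_measurable:
  assumes "\<And>i. i < N \<Longrightarrow> (\<lambda>\<omega>. g \<omega> i) \<in> borel_measurable M" and [measurable]: "h \<in> borel_measurable M"
  shows "(\<lambda>\<omega>. proj_est m N (g \<omega>) (h \<omega>)) \<in> borel_measurable M"
proof -
  have [measurable]: "(\<lambda>\<omega>. \<Sum>i<N. psi j (g \<omega> i)) \<in> borel_measurable M" for j
    by (rule borel_measurable_sum) (use assms(1) measurable_compose[OF _ psi_measurable] in auto)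
  show ?thesis unfolding proj_est_def by measurable
qed

lemma proj_est_measurable_borel [measurable]: "proj_est m N x \<in> borel_measurable borel"
  by (rule proj_est_measurable[of _ "\<lambda>_. x"]) auto

lemma abs_proj_est_le: "\<bar>proj_est m N x t\<bar> \<le> (\<Sum>j\<le>m. \<bar>emp_coeff N x j\<bar>) * sqrt 2"
  unfolding proj_est_eq by (rule abs_cosine_sum_le)

lemma integrable_sq_diff_proj_est:
  fixes f :: "real \<Rightarrow> real"
  assumes [measurable]: "f \<in> borel_measurable borel" and B: "\<And>t. \<bar>f t\<bar> \<le> B"
  shows "integrable unit_leb (\<lambda>t. (f t - proj_est m N x t)\<^sup>2)"
proof (rule integrable_unit_bounded)
  show "(\<lambda>t. (f t - proj_est m N x t)\<^sup>2) \<in> borel_measurable borel" by measurable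
  fix t
  let ?K = "(\<Sum>j\<le>m. \<bar>emp_coeff N x j\<bar>) * sqrt 2"
  have "\<bar>f t - proj_est m N x t\<bar> \<le> B + ?K"
    using B[of t] abs_proj_est_le[of m N x t] by linarith
  then show "\<bar>(f t - proj_est m N x t)\<^sup>2\<bar> \<le> (B + ?K)\<^sup>2"
    by (metis abs_ge_zero abs_power2 power2_abs power_mono)
qed

lemma integral_proj_est_diff_square:
  "(LINT t|unit_leb. (proj_est m N x t - proj_est m N' y t)\<^sup>2)
    = (\<Sum>j\<le>m. (emp_coeff N x j - emp_coeff N' y j)\<^sup>2)"
  using integral_cosine_sum_square[of "{..m}" "\<lambda>j. emp_coeff N x j - emp_coeff N' y j"]
  by (simp add: proj_est_eq sum_subtractf left_diff_distrib)

subsection \<open>Sobolev densities and the integrated squared loss\<close>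

text \<open>The coefficient sequence is extended by \<open>b 0 = 1\<close>, which absorbs the
  constant term into the series and later gives total mass 1.\<close>

locale sobolev_density =
  fixes \<gamma> C :: real and b :: "nat \<Rightarrow> real"
  assumes gamma_gt_half: "\<gamma> > 1 / 2"
    and coeff_0: "b 0 = 1"
    and coeff_summable: "summable (\<lambda>j. (b (Suc j))\<^sup>2 * real (Suc j) powr (2 * \<gamma>))"
    and coeff_sum_le: "(\<Sum>j. (b (Suc j))\<^sup>2 * real (Suc j) powr (2 * \<gamma>)) \<le> C\<^sup>2"
    and nonneg: "\<And>t. t \<in> {0..1} \<Longrightarrow> 0 \<le> 1 + (\<Sum>j. b (Suc j) * psi (Suc j) t)"
begin

text \<open>The series defines a function on the whole line, where it is bounded and measurable;
  nonnegativity is available only on the unit interval.\<close>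

definition dens :: "real \<Rightarrow> real" where
  "dens t = (\<Sum>j. b j * psi j t)"

text \<open>Write |b_j| = (|b_j| j^\<gamma>) j^(-\<gamma>) and bound the product by the sum of the
  two squares. The first gives the Sobolev series, the second converges because 2 \<gamma> >
  1.\<close>

lemma abs_summable: "summable (\<lambda>j. \<bar>b j\<bar>)"
proof -
  have "summable (\<lambda>j. (b (Suc j))\<^sup>2 * real (Suc j) powr (2 * \<gamma>) + real (Suc j) powr (- 2 * \<gamma>))"
  proof (rule summable_add[OF coeff_summable])
    have "summable (\<lambda>j. real j powr (- 2 * \<gamma>))"
      using gamma_gt_half by (simp add: summable_real_powr_iff)
    then show "summable (\<lambda>j. real (Suc j) powr (- 2 * \<gamma>))"
      by (subst summable_Suc_iff)
  qed
  moreover have "norm \<bar>b (Suc j)\<bar> \<le> (b (Suc j))\<^sup>2 * real (Suc j) powr (2 * \<gamma>) + real (Suc j) powr (- 2 * \<gamma>)" for j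
  proof -
    let ?u = "\<bar>b (Suc j)\<bar> * real (Suc j) powr \<gamma>" and ?v = "real (Suc j) powr (- \<gamma>)"
    have "0 \<le> (?u - ?v)\<^sup>2" "0 \<le> ?u\<^sup>2" "0 \<le> ?v\<^sup>2" by auto
    then have "?u * ?v \<le> ?u\<^sup>2 + ?v\<^sup>2"
      unfolding power2_diff by linarith
    moreover have "?u * ?v = \<bar>b (Suc j)\<bar>"
      by (simp add: powr_minus)
    moreover have "?u\<^sup>2 = (b (Suc j))\<^sup>2 * real (Suc j) powr (2 * \<gamma>)"
      by (simp add: power_mult_distrib powr_power mult.commute)
    moreover have "?v\<^sup>2 = real (Suc j) powr (- 2 * \<gamma>)"
      by (simp add: powr_power mult.commute)
    ultimately show ?thesis by (simp del: of_nat_Suc)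
  qed
  ultimately have "summable (\<lambda>j. \<bar>b (Suc j)\<bar>)"
    by (rule summable_comparison_test'[where N = 0])
  then show ?thesis by (subst (asm) summable_Suc_iff)
qed

definition dens_bound :: real where
  "dens_bound = (\<Sum>j. \<bar>b j\<bar>) * sqrt 2"

lemma abs_partial_sum_le: "\<bar>\<Sum>j\<le>m. b j * psi j t\<bar> \<le> dens_bound"
proof -
  have "\<bar>\<Sum>j\<le>m. b j * psi j t\<bar> \<le> (\<Sum>j\<le>m. \<bar>b j\<bar>) * sqrt 2"
    by (rule abs_cosine_sum_le)
  also have "(\<Sum>j\<le>m. \<bar>b j\<bar>) \<le> (\<Sum>j. \<bar>b j\<bar>)"
    by (rule sum_le_suminf[OF abs_summable]) auto
  finally show ?thesis by (simp add: dens_bound_def)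
qed

lemma summable_series: "summable (\<lambda>j. b j * psi j t)"
proof (rule summable_comparison_test'[where N = 0])
  show "summable (\<lambda>j. \<bar>b j\<bar> * sqrt 2)" by (intro summable_mult2 abs_summable)
  show "norm (b j * psi j t) \<le> \<bar>b j\<bar> * sqrt 2" for j
    by (auto simp: abs_mult intro!: mult_left_mono abs_psi_le)
qed

lemma dens_eq: "dens t = 1 + (\<Sum>j. b (Suc j) * psi (Suc j) t)"
  using suminf_split_head[OF summable_series[of t]] by (simp add: dens_def coeff_0)

lemma partial_sums_tendsto: "(\<lambda>m. \<Sum>j\<le>m. b j * psi j t) \<longlonglongrightarrow> dens t"
  unfolding dens_def by (rule summable_LIMSEQ'[OF summable_series])

lemma abs_dens_le: "\<bar>dens t\<bar> \<le> dens_bound"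
  by (rule LIMSEQ_le_const2[OF tendsto_rabs[OF partial_sums_tendsto]]) (auto intro: abs_partial_sum_le)

lemma dens_measurable [measurable]: "dens \<in> borel_measurable borel"
  by (rule borel_measurable_LIMSEQ_real[OF partial_sums_tendsto]) auto

lemma dens_bound_nonneg: "0 \<le> dens_bound"
  using abs_dens_le[of 0] by linarith

text \<open>For m \<ge> i the partial sums have \<open>i\<close>-th cosine coefficient exactly
  \<open>b i\<close>; dominated convergence with the constant \<open>dens_bound * sqrt 2\<close>
  passes this to the limit.\<close>

lemma integral_dens_mult_psi: "(LINT t|unit_leb. dens t * psi i t) = b i"
proof -
  have "(\<lambda>m. LINT t|unit_leb. (\<Sum>j\<le>m. b j * psi j t) * psi i t) \<longlonglongrightarrow> (LINT t|unit_leb. dens t * psi i t)"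
  proof (rule integral_dominated_convergence[where w = "\<lambda>_. dens_bound * sqrt 2"])
    show "AE t in unit_leb. (\<lambda>m. (\<Sum>j\<le>m. b j * psi j t) * psi i t) \<longlonglongrightarrow> dens t * psi i t"
      by (intro AE_I2 tendsto_mult partial_sums_tendsto tendsto_const)
    show "AE t in unit_leb. norm ((\<Sum>j\<le>m. b j * psi j t) * psi i t) \<le> dens_bound * sqrt 2" for m
      by (intro AE_I2) (auto simp: abs_mult intro!: mult_mono abs_partial_sum_le abs_psi_le dens_bound_nonneg)
  qed (auto intro!: measurable_unit_leb)
  moreover have "(\<lambda>m. LINT t|unit_leb. (\<Sum>j\<le>m. b j * psi j t) * psi i t) \<longlonglongrightarrow> b i"
    by (rule tendsto_eventually, rule eventually_sequentiallyI[of i])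
      (subst integral_cosine_sum_mult_psi, auto)
  ultimately show ?thesis by (rule LIMSEQ_unique)
qed

text \<open>Every index j > m satisfies j^(2\<gamma>) (m+1)^(-2\<gamma>) \<ge> 1. Inserting this
  factor turns the sum into a piece of the Sobolev series.\<close>

lemma sum_coeff_square_le:
  assumes "m < l"
  shows "(\<Sum>j\<in>{m<..l}. (b j)\<^sup>2) \<le> C\<^sup>2 * real (Suc m) powr (- 2 * \<gamma>)"
proof -
  have "(\<Sum>j\<in>{m<..l}. (b j)\<^sup>2)
      \<le> (\<Sum>j\<in>{m<..l}. (b j)\<^sup>2 * real j powr (2 * \<gamma>) * real (Suc m) powr (- 2 * \<gamma>))"
  proof (rule sum_mono)
    fix j assume j: "j \<in> {m<..l}"
    then have "1 = real (Suc m) powr (2 * \<gamma>) * real (Suc m) powr (- 2 * \<gamma>)"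
      by (simp flip: powr_add)
    also have "\<dots> \<le> real j powr (2 * \<gamma>) * real (Suc m) powr (- 2 * \<gamma>)"
      by (intro mult_right_mono powr_mono2) (use j gamma_gt_half in auto)
    finally have "(b j)\<^sup>2 * 1 \<le> (b j)\<^sup>2 * (real j powr (2 * \<gamma>) * real (Suc m) powr (- 2 * \<gamma>))"
      by (rule mult_left_mono) auto
    then show "(b j)\<^sup>2 \<le> (b j)\<^sup>2 * real j powr (2 * \<gamma>) * real (Suc m) powr (- 2 * \<gamma>)"
      by (simp add: mult.assoc)
  qed
  also have "\<dots> = (\<Sum>j\<in>{m<..l}. (b j)\<^sup>2 * real j powr (2 * \<gamma>)) * real (Suc m) powr (- 2 * \<gamma>)"
    by (simp only: sum_distrib_right)
  also have "(\<Sum>j\<in>{m<..l}. (b j)\<^sup>2 * real j powr (2 * \<gamma>))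
      = (\<Sum>j\<in>{m..<l}. (b (Suc j))\<^sup>2 * real (Suc j) powr (2 * \<gamma>))"
    by (rule sum.reindex_bij_witness[of _ Suc "\<lambda>j. j - 1"]) (use assms in auto)
  also have "\<dots> \<le> (\<Sum>j. (b (Suc j))\<^sup>2 * real (Suc j) powr (2 * \<gamma>))"
    by (rule sum_le_suminf[OF coeff_summable]) auto
  also have "\<dots> \<le> C\<^sup>2" by (rule coeff_sum_le)
  finally show ?thesis by (simp add: mult_right_mono)
qed

text \<open>The squared truncation bias: by Parseval the distance between two partial sums is a
  block of squared coefficients, and the longer partial sum then tends to
  \<open>dens\<close>.\<close>

lemma integral_tail_square_le:
  "(LINT t|unit_leb. (dens t - (\<Sum>j\<le>m. b j * psi j t))\<^sup>2) \<le> C\<^sup>2 * real (Suc m) powr (- 2 * \<gamma>)"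
proof (rule LIMSEQ_le_const2)
  let ?S = "\<lambda>m t. \<Sum>j\<le>m. b j * psi j t"
  have le: "\<bar>?S l t - ?S m t\<bar> \<le> 2 * dens_bound" for l t
    using abs_partial_sum_le[of t l] abs_partial_sum_le[of t m] by linarith
  show "(\<lambda>l. LINT t|unit_leb. (?S l t - ?S m t)\<^sup>2) \<longlonglongrightarrow> (LINT t|unit_leb. (dens t - ?S m t)\<^sup>2)"
  proof (rule integral_dominated_convergence[where w = "\<lambda>_. (2 * dens_bound)\<^sup>2"])
    show "AE t in unit_leb. (\<lambda>l. (?S l t - ?S m t)\<^sup>2) \<longlonglongrightarrow> (dens t - ?S m t)\<^sup>2"
      by (intro AE_I2 tendsto_power tendsto_diff partial_sums_tendsto tendsto_const)
    show "AE t in unit_leb. norm ((?S l t - ?S m t)\<^sup>2) \<le> (2 * dens_bound)\<^sup>2" for l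
      using power_mono[OF le abs_ge_zero, of _ _ 2] by (intro AE_I2) (simp only: real_norm_def power2_abs abs_power2)
  qed (auto intro!: measurable_unit_leb)
  show "\<exists>N. \<forall>l\<ge>N. (LINT t|unit_leb. (?S l t - ?S m t)\<^sup>2) \<le> C\<^sup>2 * real (Suc m) powr (- 2 * \<gamma>)"
  proof (intro exI[of _ "Suc m"] allI impI)
    fix l assume l: "Suc m \<le> l"
    have "{..l} = {..m} \<union> {m<..l}" using l by auto
    then have "?S l t = ?S m t + (\<Sum>j\<in>{m<..l}. b j * psi j t)" for t
      by (simp only:) (subst sum.union_disjoint, auto)
    then have "(LINT t|unit_leb. (?S l t - ?S m t)\<^sup>2) = (\<Sum>j\<in>{m<..l}. (b j)\<^sup>2)"
      using integral_cosine_sum_square[of "{m<..l}" b] by simp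
    then show "(LINT t|unit_leb. (?S l t - ?S m t)\<^sup>2) \<le> C\<^sup>2 * real (Suc m) powr (- 2 * \<gamma>)"
      using sum_coeff_square_le[of m l] l by simp
  qed
qed

definition loss :: "nat \<Rightarrow> nat \<Rightarrow> (nat \<Rightarrow> real) \<Rightarrow> real" where
  "loss m N x = (LINT t|unit_leb. (dens t - proj_est m N x t)\<^sup>2)"

text \<open>Bias and variance are separated by passing through the truncated series: the first part
  is the tail, the second is the Parseval sum of the coefficient errors.\<close>

lemma loss_le_coeffs:
  "loss m N x \<le> 2 * C\<^sup>2 * real (Suc m) powr (- 2 * \<gamma>)
     + 2 * (\<Sum>j\<le>m. (emp_coeff N x j - b j)\<^sup>2)"
proof -
  let ?S = "\<lambda>t. \<Sum>j\<le>m. b j * psi j t"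
  let ?D = "\<lambda>t. \<Sum>j\<le>m. (emp_coeff N x j - b j) * psi j t"
  have D: "proj_est m N x t - ?S t = ?D t" for t
    by (simp add: proj_est_eq sum_subtractf left_diff_distrib)
  have i1: "integrable unit_leb (\<lambda>t. (dens t - ?S t)\<^sup>2)"
  proof (rule integrable_unit_bounded)
    fix t
    have "\<bar>dens t - ?S t\<bar> \<le> 2 * dens_bound"
      using abs_partial_sum_le[of t m] abs_dens_le[of t] by linarith
    from power_mono[OF this abs_ge_zero, of 2]
    show "\<bar>(dens t - ?S t)\<^sup>2\<bar> \<le> (2 * dens_bound)\<^sup>2" by simp
  qed auto
  have i2: "integrable unit_leb (\<lambda>t. (?D t)\<^sup>2)"
  proof (rule integrable_unit_bounded)
    fix t
    show "\<bar>(?D t)\<^sup>2\<bar> \<le> ((\<Sum>j\<le>m. \<bar>emp_coeff N x j - b j\<bar>) * sqrt 2)\<^sup>2"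
      using power_mono[OF abs_cosine_sum_le[where J = "{..m}" and t = t] abs_ge_zero, of "\<lambda>j. emp_coeff N x j - b j" 2]
      by simp
  qed auto
  have "loss m N x \<le> 2 * (LINT t|unit_leb. (dens t - ?S t)\<^sup>2) + 2 * (LINT t|unit_leb. (?S t - proj_est m N x t)\<^sup>2)"
    unfolding loss_def by (rule integral_square_triangle[OF i1]) (use i2 D in \<open>simp add: power2_commute[of "?S _"]\<close>)
  also have "(LINT t|unit_leb. (?S t - proj_est m N x t)\<^sup>2) = (LINT t|unit_leb. (?D t)\<^sup>2)"
    by (simp only: power2_commute[of "?S _"] D)
  also have "(LINT t|unit_leb. (?D t)\<^sup>2) = (\<Sum>j\<le>m. (emp_coeff N x j - b j)\<^sup>2)"
    by (rule integral_cosine_sum_square) simp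
  finally show ?thesis using integral_tail_square_le[of m] by simp
qed

end

subsection \<open>Risk of the projection estimator\<close>

text \<open>After expanding the square, mixed terms factor by independence and vanish since
  \<open>h\<close> has mean zero; the \<open>N\<close> diagonal terms remain.\<close>

lemma expectation_sum_square_iid:
  fixes h :: "'a \<Rightarrow> real"
  assumes "prob_space \<mu>" and [measurable]: "h \<in> borel_measurable \<mu>" and bdd: "\<And>x. \<bar>h x\<bar> \<le> B"
    and mean: "(LINT x|\<mu>. h x) = 0"
  shows "(LINT x|PiM {..<N::nat} (\<lambda>_. \<mu>). (\<Sum>i<N. h (x i))\<^sup>2) = real N * (LINT x|\<mu>. (h x)\<^sup>2)"
proof -
  interpret prob_space \<mu> by fact
  interpret F: product_sigma_finite "\<lambda>_::nat. \<mu>" ..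
  interpret P: prob_space "PiM {..<N} (\<lambda>_. \<mu>)" by (rule prob_space_PiM) (rule assms(1))
  have int: "integrable \<mu> h"
    by (rule integrable_const_bound[of _ B]) (use bdd in auto)
  have int2: "integrable \<mu> (\<lambda>x. h x * h x)"
  proof (rule integrable_const_bound[of _ "B * B"])
    show "AE x in \<mu>. norm (h x * h x) \<le> B * B"
      unfolding real_norm_def abs_mult by (intro AE_I2 mult_mono bdd order.trans[OF abs_ge_zero bdd]) auto
  qed simp
  have intN: "integrable (PiM {..<N} (\<lambda>_. \<mu>)) (\<lambda>x. h (x a) * h (x c))" if "a < N" "c < N" for a c
  proof (rule P.integrable_const_bound[of _ "B * B"])
    have [measurable]: "(\<lambda>x. h (x i)) \<in> borel_measurable (PiM {..<N} (\<lambda>_. \<mu>))" if "i < N" for i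
      by (rule measurable_compose[OF measurable_component_singleton]) (use that in auto)
    show "(\<lambda>x. h (x a) * h (x c)) \<in> borel_measurable (PiM {..<N} (\<lambda>_. \<mu>))"
      using that by measurable
    show "AE x in PiM {..<N} (\<lambda>_. \<mu>). norm (h (x a) * h (x c)) \<le> B * B"
      by (auto simp: abs_mult intro!: mult_mono bdd order.trans[OF abs_ge_zero bdd])
  qed
  have E: "(LINT x|PiM {..<N} (\<lambda>_. \<mu>). h (x a) * h (x c)) = (if a = c then LINT x|\<mu>. (h x)\<^sup>2 else 0)"
    if a: "a < N" and c: "c < N" for a c
  proof -
    \<comment> \<open>The product of two coordinates is written as a product over all coordinates,
      with factor 1 at the others. Both a = c and a \<noteq> c then follow from one product
      formula.\<close>
    let ?f = "\<lambda>i y. (if i = a then h y else 1) * (if i = c then h y else 1)"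
    have intf: "integrable \<mu> (?f i)" for i
      using int int2 by (cases "i = a"; cases "i = c") simp_all
    have "h (x a) * h (x c) = (\<Prod>i<N. ?f i (x i))" for x
      using a c by (simp add: prod.distrib)
    then have "(LINT x|PiM {..<N} (\<lambda>_. \<mu>). h (x a) * h (x c)) = (\<Prod>i<N. LINT y|\<mu>. ?f i y)"
      by (simp only:) (rule F.product_integral_prod, simp, rule intf)
    also have "\<dots> = (if a = c then LINT x|\<mu>. (h x)\<^sup>2 else 0)"
    proof (cases "a = c")
      case True
      then have "(LINT y|\<mu>. ?f i y) = (if i = a then LINT x|\<mu>. (h x)\<^sup>2 else 1)" for i
        by (simp add: prob_space power2_eq_square)
      then show ?thesis using True a by simp
    next
      case False
      then have "(LINT y|\<mu>. ?f a y) = 0" using mean by simp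
      then have "\<exists>i\<in>{..<N}. (LINT y|\<mu>. ?f i y) = 0" using a by (intro bexI[of _ a]) auto
      then show ?thesis using False by (subst prod_zero) simp_all
    qed
    finally show ?thesis .
  qed
  have "(LINT x|PiM {..<N} (\<lambda>_. \<mu>). (\<Sum>i<N. h (x i))\<^sup>2)
      = (LINT x|PiM {..<N} (\<lambda>_. \<mu>). (\<Sum>a<N. \<Sum>c<N. h (x a) * h (x c)))"
    by (simp add: power2_eq_square sum_product)
  also have "\<dots> = (\<Sum>a<N. \<Sum>c<N. (LINT x|PiM {..<N} (\<lambda>_. \<mu>). h (x a) * h (x c)))"
    by (subst Bochner_Integration.integral_sum,
        fastforce intro!: Bochner_Integration.integrable_sum intN)
      (intro sum.cong refl Bochner_Integration.integral_sum intN, auto)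
  also have "\<dots> = (\<Sum>a<N. \<Sum>c<N. (if a = c then LINT x|\<mu>. (h x)\<^sup>2 else 0))"
    by (simp add: E)
  finally show ?thesis by simp
qed

text \<open>Both measures agree on boxes, where the integral of a product factors. This identifies
  the data part of \<open>joint_law\<close> with an i.i.d. sample.\<close>

lemma density_PiM_lborel:
  fixes f :: "real \<Rightarrow> ennreal"
  assumes [measurable]: "f \<in> borel_measurable borel" and "prob_space (density lborel f)"
  shows "density (PiM {..<N::nat} (\<lambda>_. lborel)) (\<lambda>x. \<Prod>i<N. f (x i)) = PiM {..<N} (\<lambda>_. density lborel f)"
proof -
  interpret prob_space "density lborel f" by fact
  interpret F: product_sigma_finite "\<lambda>_::nat. density lborel f" ..
  interpret L: product_sigma_finite "\<lambda>_::nat. lborel :: real measure" ..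
  show ?thesis
  proof (rule F.PiM_eqI)
    show "sets (density (PiM {..<N} (\<lambda>_. lborel)) (\<lambda>x. \<Prod>i<N. f (x i))) = sets (PiM {..<N} (\<lambda>_. density lborel f))"
      by (simp cong: sets_PiM_cong)
    fix A :: "nat \<Rightarrow> real set"
    assume A: "\<And>i. i \<in> {..<N} \<Longrightarrow> A i \<in> sets (density lborel f)"
    have box: "Pi\<^sub>E {..<N} A \<in> sets (PiM {..<N} (\<lambda>_. lborel))"
      using A by (intro sets_PiM_I_finite) auto
    have [measurable]: "(\<lambda>x. \<Prod>i<N. f (x i)) \<in> borel_measurable (PiM {..<N} (\<lambda>_. lborel))"
      by (intro borel_measurable_prod_ennreal measurable_compose[OF measurable_component_singleton]) auto
    have "emeasure (density (PiM {..<N} (\<lambda>_. lborel)) (\<lambda>x. \<Prod>i<N. f (x i))) (Pi\<^sub>E {..<N} A)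
        = (\<integral>\<^sup>+x. (\<Prod>i<N. f (x i)) * indicator (Pi\<^sub>E {..<N} A) x \<partial>PiM {..<N} (\<lambda>_. lborel))"
      using box by (intro emeasure_density) auto
    also have "\<dots> = (\<integral>\<^sup>+x. (\<Prod>i<N. f (x i) * indicator (A i) (x i)) \<partial>PiM {..<N} (\<lambda>_. lborel))"
    proof (intro nn_integral_cong)
      fix x :: "nat \<Rightarrow> real" assume "x \<in> space (PiM {..<N} (\<lambda>_. lborel))"
      then have "indicator (Pi\<^sub>E {..<N} A) x = (\<Prod>i<N. indicator (A i) (x i) :: ennreal)"
        by (auto simp: space_PiM PiE_iff indicator_def)
      then show "(\<Prod>i<N. f (x i)) * indicator (Pi\<^sub>E {..<N} A) x = (\<Prod>i<N. f (x i) * indicator (A i) (x i))"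
        by (simp add: prod.distrib)
    qed
    also have "\<dots> = (\<Prod>i<N. \<integral>\<^sup>+y. f y * indicator (A i) y \<partial>lborel)"
      using A by (intro L.product_nn_integral_prod) auto
    also have "\<dots> = (\<Prod>i<N. emeasure (density lborel f) (A i))"
      using A by (intro prod.cong) (auto simp: emeasure_density)
    finally show "emeasure (density (PiM {..<N} (\<lambda>_. lborel)) (\<lambda>x. \<Prod>i<N. f (x i))) (Pi\<^sub>E {..<N} A)
        = (\<Prod>i<N. emeasure (density lborel f) (A i))" .
  qed auto
qed

section \<open>The sampling law and its expected loss\<close>

context sobolev_density
begin

definition ddens :: "real \<Rightarrow> ennreal" where
  "ddens t = ennreal (indicator {0..1} t * dens t)"

definition law :: "real measure" where
  "law = density lborel ddens"

lemma ddens_measurable [measurable]: "ddens \<in> borel_measurable borel"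
  unfolding ddens_def[abs_def] by measurable

lemma sets_law [measurable_cong, simp]: "sets law = sets borel"
  by (simp add: law_def)

lemma space_law [simp]: "space law = UNIV"
  by (simp add: law_def)

lemma indicator_dens_nonneg: "0 \<le> indicator {0..1} t * dens t"
  using nonneg[of t] by (auto simp: dens_eq indicator_def)

lemma integral_law:
  assumes [measurable]: "f \<in> borel_measurable borel"
  shows "(LINT t|law. f t) = (LINT t|unit_leb. dens t * f t)"
proof -
  have "(LINT t|law. f t) = (LINT t|lborel. (indicator {0..1} t * dens t) *\<^sub>R f t)"
    unfolding law_def ddens_def using indicator_dens_nonneg
    by (intro integral_density) auto
  then show ?thesis
    unfolding set_integral_unit[symmetric] set_lebesgue_integral_def by (simp add: mult.assoc)
qed

text \<open>The total mass is the integral of \<open>dens\<close> against \<open>psi 0\<close>,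
  hence the coefficient \<open>b 0 = 1\<close>.\<close>

lemma prob_space_law: "prob_space law"
proof (rule prob_spaceI)
  have int: "integrable lborel (\<lambda>t. indicator {0..1} t * dens t)"
  proof -
    have "integrable unit_leb dens"
      by (rule integrable_unit_bounded) (auto intro: abs_dens_le)
    then show ?thesis by (simp add: unit_leb_def integrable_restrict_space)
  qed
  have "emeasure law (space law) = (\<integral>\<^sup>+t. ennreal (indicator {0..1} t * dens t) \<partial>lborel)"
    by (simp add: law_def emeasure_density ddens_def)
  also have "\<dots> = ennreal (LINT t|lborel. indicator {0..1} t * dens t)"
    by (rule nn_integral_eq_integral) (use int indicator_dens_nonneg in auto)
  also have "(LINT t|lborel. indicator {0..1} t * dens t) = (LINT t|unit_leb. dens t * psi 0 t)"
    unfolding set_integral_unit[symmetric] set_lebesgue_integral_def by simp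
  finally show "emeasure law (space law) = 1" by (simp only: integral_dens_mult_psi coeff_0 ennreal_1)
qed

sublocale law: prob_space law
  by (rule prob_space_law)

lemma AE_law_unit: "AE t in law. t \<in> {0..1}"
  unfolding law_def by (subst AE_density) (auto simp: ddens_def indicator_def)

lemma law_variance_psi_le: "(LINT t|law. (psi j t - b j)\<^sup>2) \<le> 2"
proof -
  have int: "integrable law (psi j)"
    by (rule law.integrable_const_bound[of _ "sqrt 2"]) (auto intro: abs_psi_le)
  have int2: "integrable law (\<lambda>t. (psi j t)\<^sup>2)"
    by (rule law.integrable_const_bound[of _ "(sqrt 2)\<^sup>2"])
      (auto intro!: power2_le_iff_abs_le[THEN iffD2] abs_psi_le simp del: real_sqrt_pow2)
  have mean: "(LINT t|law. psi j t) = b j"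
    by (simp add: integral_law integral_dens_mult_psi)
  have "(LINT t|law. (psi j t - b j)\<^sup>2) = (LINT t|law. (psi j t)\<^sup>2) - (b j)\<^sup>2"
    using law.variance_eq[OF int int2] mean by simp
  also have "(LINT t|law. (psi j t)\<^sup>2) \<le> 2"
  proof (rule law.integral_le_const[OF int2], rule AE_I2)
    show "(psi j t)\<^sup>2 \<le> 2" for t
      using power_mono[OF abs_psi_le abs_ge_zero, of j t 2] by simp
  qed
  finally show ?thesis using zero_le_power2[of "b j"] by linarith
qed

text \<open>Twice the squared bias plus twice the variance, the latter from \<open>m\<close>
  coefficients of variance at most 2 / N each.\<close>

definition risk_bound :: "nat \<Rightarrow> nat \<Rightarrow> real" where
  "risk_bound m N = 2 * C\<^sup>2 * real (Suc m) powr (- 2 * \<gamma>) + 4 * real m / real N"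

text \<open>A majorant of \<open>loss\<close> that is an explicit polynomial in the empirical
  coefficients, so that its integrability and expectation reduce to those of single
  coefficients.\<close>

definition loss_bound :: "nat \<Rightarrow> nat \<Rightarrow> (nat \<Rightarrow> real) \<Rightarrow> real" where
  "loss_bound m N x = 2 * C\<^sup>2 * real (Suc m) powr (- 2 * \<gamma>)
     + 2 * (\<Sum>j\<le>m. (emp_coeff N x j - b j)\<^sup>2)"

lemma
  assumes N: "N > 0"
  shows integrable_loss_bound: "integrable (PiM {..<N} (\<lambda>_. law)) (loss_bound m N)"
    and expectation_loss_bound: "(LINT x|PiM {..<N} (\<lambda>_. law). loss_bound m N x) \<le> risk_bound m N"
proof -
  let ?P = "PiM {..<N} (\<lambda>_. law)"
  interpret P: prob_space ?P by (rule prob_space_PiM) (rule prob_space_law)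
  have dev: "emp_coeff N x j - b j = (\<Sum>i<N. psi j (x i) - b j) / real N" if "j \<noteq> 0" for x j
    using N that by (simp add: emp_coeff_def sum_subtractf diff_divide_distrib)
  have [measurable]: "(\<lambda>x. psi j (x i)) \<in> borel_measurable ?P" if "i < N" for i j
    by (rule measurable_compose[OF measurable_component_singleton]) (use that in auto)
  have bd: "\<bar>psi j t - b j\<bar> \<le> sqrt 2 + \<bar>b j\<bar>" for j t
    using abs_psi_le[of j t] by linarith
  have intj: "integrable ?P (\<lambda>x. (\<Sum>i<N. psi j (x i) - b j)\<^sup>2)" for j
  proof (rule P.integrable_const_bound)
    have "\<bar>\<Sum>i<N. psi j (x i) - b j\<bar> \<le> real N * (sqrt 2 + \<bar>b j\<bar>)" for x
      using sum_norm_bound[of "{..<N}" "\<lambda>i. psi j (x i) - b j" "sqrt 2 + \<bar>b j\<bar>"] bd by simp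
    from power_mono[OF this abs_ge_zero, of _ 2]
    show "AE x in ?P. norm ((\<Sum>i<N. psi j (x i) - b j)\<^sup>2) \<le> (real N * (sqrt 2 + \<bar>b j\<bar>))\<^sup>2"
      by (intro AE_I2) (simp only: real_norm_def power2_abs abs_power2)
  qed measurable
  \<comment> \<open>The coefficient at index 0 is known exactly and carries no error, which is why
    the variance term has \<open>m\<close> and not \<open>m + 1\<close> summands.\<close>
  have coeff: "integrable ?P (\<lambda>x. (emp_coeff N x j - b j)\<^sup>2) \<and>
      (LINT x|?P. (emp_coeff N x j - b j)\<^sup>2) \<le> (if j = 0 then 0 else 2 / real N)" for j
  proof (cases "j = 0")
    case True
    then show ?thesis by (simp add: emp_coeff_def coeff_0)
  next
    case False
    have mean: "(LINT t|law. psi j t - b j) = 0"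
    proof -
      have "integrable law (psi j)"
        by (rule law.integrable_const_bound[of _ "sqrt 2"]) (auto intro: abs_psi_le)
      then show ?thesis using law.prob_space by (simp add: integral_law integral_dens_mult_psi)
    qed
    have "(LINT x|?P. (\<Sum>i<N. psi j (x i) - b j)\<^sup>2) = real N * (LINT t|law. (psi j t - b j)\<^sup>2)"
      by (rule expectation_sum_square_iid[OF prob_space_law _ bd mean]) simp
    also have "\<dots> \<le> real N * 2"
      by (intro mult_left_mono law_variance_psi_le) simp
    finally have "(LINT x|?P. (\<Sum>i<N. psi j (x i) - b j)\<^sup>2) / (real N)\<^sup>2 \<le> real N * 2 / (real N)\<^sup>2"
      by (rule divide_right_mono) simp
    then show ?thesis using False N intj
      by (simp add: dev power_divide) (simp add: power2_eq_square)
  qed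
  show "integrable ?P (loss_bound m N)"
    unfolding loss_bound_def[abs_def] using coeff by simp
  have "(LINT x|?P. loss_bound m N x) = 2 * C\<^sup>2 * real (Suc m) powr (- 2 * \<gamma>)
      + 2 * (\<Sum>j\<le>m. LINT x|?P. (emp_coeff N x j - b j)\<^sup>2)"
    unfolding loss_bound_def using coeff P.prob_space by simp
  also have "(\<Sum>j\<le>m. LINT x|?P. (emp_coeff N x j - b j)\<^sup>2) \<le> (\<Sum>j\<le>m. if j = 0 then 0 else 2 / real N)"
    using coeff by (intro sum_mono) auto
  also have "(\<Sum>j\<le>m. if j = 0 then 0 else 2 / real N) = real m * (2 / real N)"
  proof -
    have "{..m} = insert 0 {1..m}" by auto
    then show ?thesis by simp
  qed
  finally show "(LINT x|?P. loss_bound m N x) \<le> risk_bound m N"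
    by (simp add: risk_bound_def)
qed

lemma loss_le_loss_bound: "loss m N x \<le> loss_bound m N x"
  using loss_le_coeffs by (simp add: loss_bound_def)

lemma loss_bound_nonneg: "0 \<le> loss_bound m N x"
  by (auto simp: loss_bound_def intro!: add_nonneg_nonneg mult_nonneg_nonneg sum_nonneg)

lemma prob_loss_bound_gt_le:
  assumes "N > 0" "s > 0"
  shows "emeasure (PiM {..<N} (\<lambda>_. law)) {x \<in> space (PiM {..<N} (\<lambda>_. law)). s \<le> loss_bound m N x}
    \<le> ennreal (risk_bound m N / s)"
proof -
  let ?P = "PiM {..<N} (\<lambda>_. law)"
  have "emeasure ?P {x \<in> space ?P. s \<le> loss_bound m N x} \<le> ennreal (1 / s * (LINT x|?P. loss_bound m N x))"
    by (rule integral_Markov_inequality) (use assms integrable_loss_bound loss_bound_nonneg in auto)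
  also have "\<dots> \<le> ennreal (risk_bound m N / s)"
    using expectation_loss_bound[OF assms(1), of m] assms(2) by (intro ennreal_leI) (simp add: divide_right_mono)
  finally show ?thesis .
qed

text \<open>The probabilistic method: a sample from \<open>law\<close> lies in the cube almost
  surely, so if every point of the cube had loss above \<open>risk_bound\<close>, the expectation of
  \<open>loss_bound\<close> would exceed it too.\<close>

lemma exists_sample_loss_le:
  assumes N: "N > 0"
  obtains z where "\<And>i. i < N \<Longrightarrow> z i \<in> {0..1}" "loss m N z \<le> risk_bound m N"
proof -
  let ?P = "PiM {..<N} (\<lambda>_. law)"
  interpret P: prob_space ?P by (rule prob_space_PiM) (rule prob_space_law)
  have AE: "AE x in ?P. \<forall>i\<in>{..<N}. x i \<in> {0..1}"
    by (intro AE_finite_allI AE_PiM_component prob_space_law AE_law_unit) auto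
  have "\<exists>z. (\<forall>i<N. z i \<in> {0..1}) \<and> loss m N z \<le> risk_bound m N"
  proof (rule ccontr)
    assume *: "\<not> ?thesis"
    have "AE x in ?P. risk_bound m N < loss_bound m N x"
      using AE
    proof eventually_elim
      case (elim x)
      then have "risk_bound m N < loss m N x" using * by (meson lessThan_iff not_le)
      then show ?case using loss_le_loss_bound[of m N x] by linarith
    qed
    with integrable_loss_bound[OF N] have "risk_bound m N < (LINT x|?P. loss_bound m N x)"
      by (intro P.expectation_greater) auto
    then show False using expectation_loss_bound[OF N, of m] by linarith
  qed
  then show thesis using that by blast
qed

end

subsection \<open>The exponential mechanism\<close>

abbreviation leb_pi :: "nat \<Rightarrow> (nat \<Rightarrow> real) measure" where
  "leb_pi N \<equiv> PiM {..<N} (\<lambda>_. lborel)"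

interpretation lborel_pi: product_sigma_finite "\<lambda>_::nat. lborel :: real measure" ..

lemma sigma_finite_leb_pi: "sigma_finite_measure (leb_pi N)"
  by (rule lborel_pi.sigma_finite) simp

lemma sigma_finite_unit_leb: "sigma_finite_measure unit_leb" ..

lemma measurable_leb_pi_component:
  assumes "i < N" "g \<in> M \<rightarrow>\<^sub>M leb_pi N"
  shows "(\<lambda>\<omega>. g \<omega> i) \<in> borel_measurable M"
proof -
  have "(\<lambda>x. x i) \<in> leb_pi N \<rightarrow>\<^sub>M lborel"
    using assms(1) by (intro measurable_component_singleton) auto
  from measurable_compose[OF assms(2) this] show ?thesis by simp
qed

lemma integral_unit_measurable:
  assumes "(\<lambda>(\<omega>, t). f \<omega> t) \<in> borel_measurable (M \<Otimes>\<^sub>M borel)"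
  shows "(\<lambda>\<omega>. LINT t|unit_leb. f \<omega> t :: real) \<in> borel_measurable M"
proof (rule sigma_finite_measure.borel_measurable_lebesgue_integral[OF sigma_finite_unit_leb])
  have "(\<lambda>\<omega>. (fst \<omega>, snd \<omega>)) \<in> M \<Otimes>\<^sub>M unit_leb \<rightarrow>\<^sub>M M \<Otimes>\<^sub>M borel"
    by (intro measurable_Pair measurable_fst measurable_compose[OF measurable_snd] measurable_unit_leb) auto
  then have "(\<lambda>\<omega>. \<omega>) \<in> M \<Otimes>\<^sub>M unit_leb \<rightarrow>\<^sub>M M \<Otimes>\<^sub>M borel" by simp
  from measurable_compose[OF this assms]
  show "(\<lambda>(\<omega>, t). f \<omega> t) \<in> borel_measurable (M \<Otimes>\<^sub>M unit_leb)" by simp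
qed

lemma proj_est_measurable_pair:
  assumes "g \<in> M \<rightarrow>\<^sub>M leb_pi N"
  shows "(\<lambda>(\<omega>, t). proj_est m N (g \<omega>) t) \<in> borel_measurable (M \<Otimes>\<^sub>M borel)"
proof -
  have "(\<lambda>\<omega>. proj_est m N (g (fst \<omega>)) (snd \<omega>)) \<in> borel_measurable (M \<Otimes>\<^sub>M borel)"
  proof (rule proj_est_measurable[where h = snd and g = "\<lambda>\<omega>. g (fst \<omega>)"])
    show "(\<lambda>\<omega>. g (fst \<omega>) i) \<in> borel_measurable (M \<Otimes>\<^sub>M borel)" if "i < N" for i
      using measurable_leb_pi_component[OF that assms] by (rule measurable_compose[OF measurable_fst])
  qed simp
  then show ?thesis by (simp add: case_prod_beta')
qed

lemma xi_measurable [measurable]: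
  assumes "f \<in> M \<rightarrow>\<^sub>M leb_pi n" "g \<in> M \<rightarrow>\<^sub>M leb_pi k"
  shows "(\<lambda>\<omega>. xi \<gamma> n k (f \<omega>) (g \<omega>)) \<in> borel_measurable M"
proof -
  note [measurable] = proj_est_measurable_pair[OF assms(1), simplified case_prod_beta']
    proj_est_measurable_pair[OF assms(2), simplified case_prod_beta']
  have "(\<lambda>\<omega>. LINT t|unit_leb. (p_hat \<gamma> n (f \<omega>) t - p_star \<gamma> k (g \<omega>) t)\<^sup>2) \<in> borel_measurable M"
    unfolding p_hat_def p_star_def case_prod_beta'
    by (rule integral_unit_measurable) (unfold case_prod_beta', measurable)
  then show ?thesis unfolding xi_def set_integral_unit by measurable
qed

lemma weight_measurable [measurable]:
  assumes "f \<in> M \<rightarrow>\<^sub>M leb_pi n" "g \<in> M \<rightarrow>\<^sub>M leb_pi k"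
  shows "(\<lambda>\<omega>. weight \<alpha> \<gamma> n k (f \<omega>) (g \<omega>)) \<in> borel_measurable M"
proof -
  note [measurable] = xi_measurable[OF assms]
  have ind: "(\<lambda>t::real. indicator {0..1} t :: ennreal) \<in> borel_measurable borel"
    by (intro borel_measurable_indicator) simp
  have [measurable]: "(\<lambda>\<omega>. \<Prod>i<k. indicator {0..1} (g \<omega> i) :: ennreal) \<in> borel_measurable M"
    by (intro borel_measurable_prod_ennreal measurable_compose[OF measurable_leb_pi_component[OF _ assms(2)] ind]) auto
  show ?thesis unfolding weight_def by measurable
qed

lemma normaliser_measurable [measurable]:
  "normaliser \<alpha> \<gamma> n k \<in> borel_measurable (leb_pi n)"
  unfolding normaliser_def[abs_def]
  by (rule sigma_finite_measure.borel_measurable_nn_integral[OF sigma_finite_leb_pi])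
    (unfold case_prod_beta', rule weight_measurable[OF measurable_fst measurable_snd])

definition unit_cube :: "nat \<Rightarrow> (nat \<Rightarrow> real) set" where
  "unit_cube N = Pi\<^sub>E {..<N} (\<lambda>_. {0..1})"

lemma sets_unit_cube [measurable, simp]: "unit_cube N \<in> sets (leb_pi N)"
  unfolding unit_cube_def by (intro sets_PiM_I_finite) auto

lemma emeasure_unit_cube: "emeasure (leb_pi N) (unit_cube N) = 1"
  unfolding unit_cube_def by (subst lborel_pi.emeasure_PiM) auto

lemma weight_eq:
  assumes "z \<in> space (leb_pi k)"
  shows "weight \<alpha> \<gamma> n k x z = indicator (unit_cube k) z * ennreal (exp (- \<alpha> * xi \<gamma> n k x z / (2 * Delta \<gamma> n)))"
proof -
  have "(\<Prod>i<k. indicator {0..1} (z i)) = (indicator (unit_cube k) z :: ennreal)"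
    using assms by (auto simp: space_PiM PiE_iff indicator_def unit_cube_def)
  then show ?thesis by (simp add: weight_def)
qed

text \<open>The conditional probability of the output lying in \<open>A\<close> given the data
  \<open>x\<close>.\<close>

definition output_prob :: "real \<Rightarrow> real \<Rightarrow> nat \<Rightarrow> nat \<Rightarrow> (nat \<Rightarrow> real) set \<Rightarrow> (nat \<Rightarrow> real) \<Rightarrow> ennreal" where
  "output_prob \<alpha> \<gamma> n k A x = (\<integral>\<^sup>+z. weight \<alpha> \<gamma> n k x z * indicator A z \<partial>leb_pi k) / normaliser \<alpha> \<gamma> n k x"

lemma output_prob_le_1:
  assumes [measurable]: "A \<in> sets (leb_pi k)" and x: "x \<in> space (leb_pi n)"
  shows "output_prob \<alpha> \<gamma> n k A x \<le> 1"
proof -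
  have "(\<integral>\<^sup>+z. weight \<alpha> \<gamma> n k x z * indicator A z \<partial>leb_pi k) \<le> normaliser \<alpha> \<gamma> n k x"
    unfolding normaliser_def by (intro nn_integral_mono) (auto simp: indicator_def)
  then have "output_prob \<alpha> \<gamma> n k A x \<le> normaliser \<alpha> \<gamma> n k x / normaliser \<alpha> \<gamma> n k x"
    unfolding output_prob_def by (rule divide_right_mono_ennreal)
  \<comment> \<open>In \<open>ennreal\<close> both 0 / 0 and top / top equal 0, so the bound also
    covers degenerate normalisers.\<close>
  also have "\<dots> \<le> 1"
    by (cases "normaliser \<alpha> \<gamma> n k x = 0 \<or> normaliser \<alpha> \<gamma> n k x = top") (auto simp: ennreal_divide_self top.not_eq_extremum)
  finally show ?thesis .
qed

text \<open>The weight on \<open>A\<close> is at most its value at score \<open>s\<close>, over a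
  cube of volume 1; the normaliser is at least the value at score \<open>t\<close> times the volume
  of \<open>B\<close>. The quotient depends on the gap s - t and on \<open>v\<close>.\<close>

lemma output_prob_le:
  assumes A [measurable]: "A \<in> sets (leb_pi k)" and B [measurable]: "B \<in> sets (leb_pi k)"
    and x: "x \<in> space (leb_pi n)" and BS: "B \<subseteq> unit_cube k"
    and lower: "\<And>z. z \<in> A \<Longrightarrow> s \<le> xi \<gamma> n k x z" and upper: "\<And>z. z \<in> B \<Longrightarrow> xi \<gamma> n k x z \<le> t"
    and v: "v > 0" "ennreal v \<le> emeasure (leb_pi k) B"
    and pos: "\<alpha> \<ge> 0" "Delta \<gamma> n > 0"
  shows "output_prob \<alpha> \<gamma> n k A x \<le> ennreal (exp (- \<alpha> * (s - t) / (2 * Delta \<gamma> n)) / v)"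
proof -
  let ?e = "\<lambda>s. exp (- \<alpha> * s / (2 * Delta \<gamma> n))"
  have e_mono: "?e b \<le> ?e a" if "a \<le> b" for a b
    using that pos by (auto intro!: divide_right_mono mult_left_mono)
  have "(\<integral>\<^sup>+z. weight \<alpha> \<gamma> n k x z * indicator A z \<partial>leb_pi k) \<le> (\<integral>\<^sup>+z. ennreal (?e s) * indicator (unit_cube k) z \<partial>leb_pi k)"
  proof (rule nn_integral_mono)
    fix z assume "z \<in> space (leb_pi k)"
    then show "weight \<alpha> \<gamma> n k x z * indicator A z \<le> ennreal (?e s) * indicator (unit_cube k) z"
      using e_mono[OF lower[of z]] by (auto simp: weight_eq indicator_def)
  qed
  also have "\<dots> = ennreal (?e s)"
    by (simp add: nn_integral_cmult_indicator emeasure_unit_cube)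
  finally have num: "(\<integral>\<^sup>+z. weight \<alpha> \<gamma> n k x z * indicator A z \<partial>leb_pi k) \<le> ennreal (?e s)" .
  have "ennreal (?e t * v) \<le> ennreal (?e t) * emeasure (leb_pi k) B"
    using v by (simp add: ennreal_mult mult_left_mono)
  also have "\<dots> = (\<integral>\<^sup>+z. ennreal (?e t) * indicator B z \<partial>leb_pi k)"
    by (simp add: nn_integral_cmult_indicator)
  also have "\<dots> \<le> normaliser \<alpha> \<gamma> n k x"
    unfolding normaliser_def
  proof (rule nn_integral_mono)
    fix z assume "z \<in> space (leb_pi k)"
    then show "ennreal (?e t) * indicator B z \<le> weight \<alpha> \<gamma> n k x z"
      using e_mono[OF upper[of z]] BS by (auto simp: weight_eq indicator_def)
  qed
  finally have den: "ennreal (?e t * v) \<le> normaliser \<alpha> \<gamma> n k x" .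
  let ?q = "exp (- \<alpha> * (s - t) / (2 * Delta \<gamma> n)) / v"
  have "?e s = ?e t * exp (- \<alpha> * (s - t) / (2 * Delta \<gamma> n))"
    by (simp add: algebra_simps diff_divide_distrib flip: exp_add)
  then have "?e s = ?e t * v * ?q" using v by simp
  then have "ennreal (?e s) = ennreal (?e t * v) * ennreal ?q"
    using v by (simp flip: ennreal_mult)
  also have "\<dots> \<le> normaliser \<alpha> \<gamma> n k x * ennreal ?q"
    using den by (intro mult_right_mono) auto
  finally have "(\<integral>\<^sup>+z. weight \<alpha> \<gamma> n k x z * indicator A z \<partial>leb_pi k) \<le> normaliser \<alpha> \<gamma> n k x * ennreal ?q"
    using num by (rule order.trans[rotated])
  \<comment> \<open>Dividing by the normaliser requires it to be positive, which the lower bound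
    over \<open>B\<close> supplies.\<close>
  moreover have "0 < ennreal (?e t * v)" using v by simp
  then have "0 < normaliser \<alpha> \<gamma> n k x" using den by (rule less_le_trans)
  ultimately show ?thesis
    unfolding output_prob_def by (intro divide_le_posI_ennreal)
qed

lemma exists_small_box:
  assumes z: "\<And>i. i < N \<Longrightarrow> z i \<in> {0..1}" and d: "0 < d" "d \<le> 1"
  obtains B where "B \<in> sets (leb_pi N)" "B \<subseteq> unit_cube N" "ennreal (d ^ N) \<le> emeasure (leb_pi N) B"
    "\<And>w i. w \<in> B \<Longrightarrow> i < N \<Longrightarrow> \<bar>w i - z i\<bar> \<le> d"
proof
  let ?I = "\<lambda>i. {max 0 (z i - d)..min 1 (z i + d)}"
  let ?B = "Pi\<^sub>E {..<N} ?I"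
  show "?B \<in> sets (leb_pi N)" by (intro sets_PiM_I_finite) auto
  show "?B \<subseteq> unit_cube N" unfolding unit_cube_def by (intro PiE_mono) auto
  \<comment> \<open>Clipping one end of the window of length 2 d removes at most d, since
    \<open>z i\<close> lies in the unit interval. If both ends are clipped the length is 1 \<ge>
    d.\<close>
  have I: "d \<le> min 1 (z i + d) - max 0 (z i - d)" if "i < N" for i
    using z[OF that] d by (auto simp: min_def max_def)
  have "ennreal (d ^ N) = ennreal (\<Prod>i<N. d)" by simp
  also have "\<dots> \<le> ennreal (\<Prod>i<N. min 1 (z i + d) - max 0 (z i - d))"
    using I d by (intro ennreal_leI prod_mono) auto
  also have "\<dots> = (\<Prod>i<N. ennreal (min 1 (z i + d) - max 0 (z i - d)))"
    using I d by (intro prod_ennreal[symmetric]) (meson lessThan_iff less_le_trans less_imp_le)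
  also have "\<dots> = (\<Prod>i<N. emeasure lborel (?I i))"
  proof (rule prod.cong)
    fix i assume "i \<in> {..<N}"
    with I[of i] d have "max 0 (z i - d) \<le> min 1 (z i + d)" by simp
    then show "ennreal (min 1 (z i + d) - max 0 (z i - d)) = emeasure lborel (?I i)" by simp
  qed simp
  also have "\<dots> = emeasure (leb_pi N) ?B" by (subst lborel_pi.emeasure_PiM) auto
  finally show "ennreal (d ^ N) \<le> emeasure (leb_pi N) ?B" .
  show "\<bar>w i - z i\<bar> \<le> d" if "w \<in> ?B" "i < N" for w i
    using PiE_mem[OF that(1), of i] that(2) by (auto simp: abs_le_iff)
qed

text \<open>Values outside the unit interval are multiplied by the indicator 0, so any
  representative of the density may be replaced by \<open>dens\<close>.\<close>

lemma joint_law_cong: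
  assumes "\<And>t. t \<in> {0..1} \<Longrightarrow> p t = q t"
  shows "joint_law \<alpha> \<gamma> p n k = joint_law \<alpha> \<gamma> q n k"
proof -
  have "indicator {0..1} t * p t = indicator {0..1} t * q t" for t
    using assms by (simp add: indicator_def)
  then show ?thesis by (simp only: joint_law_def)
qed

section \<open>Disintegration of the joint law\<close>

context sobolev_density
begin

lemma law_pi_eq: "PiM {..<n} (\<lambda>_. law) = density (leb_pi n) (\<lambda>x. \<Prod>i<n. ddens (x i))"
  using density_PiM_lborel[of ddens n] prob_space_law unfolding law_def by simp

text \<open>By Tonelli, integrating over the output first leaves the conditional probability; the
  product of densities is then absorbed into the i.i.d. law of the data.\<close>

lemma emeasure_joint_law:
  assumes A [measurable]: "A \<in> sets (leb_pi k)"
  shows "emeasure (joint_law \<alpha> \<gamma> dens n k) (space (leb_pi n) \<times> A)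
    = (\<integral>\<^sup>+x. output_prob \<alpha> \<gamma> n k A x \<partial>PiM {..<n} (\<lambda>_. law))"
proof -
  interpret Q: sigma_finite_measure "leb_pi k" by (rule sigma_finite_leb_pi)
  let ?F = "\<lambda>x. \<Prod>i<n. ddens (x i)"
  let ?w = "weight \<alpha> \<gamma> n k" and ?c = "normaliser \<alpha> \<gamma> n k"
  have F [measurable]: "?F \<in> borel_measurable (leb_pi n)"
    by (intro borel_measurable_prod_ennreal measurable_compose[OF measurable_component_singleton]) auto
  have [measurable]: "(\<lambda>xz. ?w (fst xz) (snd xz)) \<in> borel_measurable (leb_pi n \<Otimes>\<^sub>M leb_pi k)"
    by (rule weight_measurable[OF measurable_fst measurable_snd])
  have d [measurable]: "(\<lambda>(x, z). ?F x * ?w x z / ?c x) \<in> borel_measurable (leb_pi n \<Otimes>\<^sub>M leb_pi k)"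
    unfolding case_prod_beta' by measurable
  have "emeasure (joint_law \<alpha> \<gamma> dens n k) (space (leb_pi n) \<times> A)
    = (\<integral>\<^sup>+xz. (\<lambda>(x, z). ?F x * ?w x z / ?c x) xz * indicator (space (leb_pi n) \<times> A) xz \<partial>(leb_pi n \<Otimes>\<^sub>M leb_pi k))"
    using d unfolding joint_law_def ddens_def by (intro emeasure_density) auto
  also have "\<dots> = (\<integral>\<^sup>+x. \<integral>\<^sup>+z. (\<lambda>(x, z). ?F x * ?w x z / ?c x) (x, z) * indicator (space (leb_pi n) \<times> A) (x, z) \<partial>leb_pi k \<partial>leb_pi n)"
    by (rule Q.nn_integral_fst[symmetric]) measurable
  also have "\<dots> = (\<integral>\<^sup>+x. ?F x * output_prob \<alpha> \<gamma> n k A x \<partial>leb_pi n)"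
  proof (rule nn_integral_cong)
    fix x assume x: "x \<in> space (leb_pi n)"
    have [measurable]: "?w x \<in> borel_measurable (leb_pi k)"
      using weight_measurable[where f = "\<lambda>_. x" and g = "\<lambda>z. z" and M = "leb_pi k"] x by simp
    have "(\<integral>\<^sup>+z. (\<lambda>(x, z). ?F x * ?w x z / ?c x) (x, z) * indicator (space (leb_pi n) \<times> A) (x, z) \<partial>leb_pi k)
      = (\<integral>\<^sup>+z. ?F x * ((?w x z * indicator A z) / ?c x) \<partial>leb_pi k)"
      using x by (intro nn_integral_cong) (simp add: indicator_def divide_ennreal_def mult_ac)
    also have "\<dots> = ?F x * output_prob \<alpha> \<gamma> n k A x"
      unfolding output_prob_def by (subst nn_integral_cmult) (auto simp: nn_integral_divide)
    finally show "(\<integral>\<^sup>+z. (\<lambda>(x, z). ?F x * ?w x z / ?c x) (x, z) * indicator (space (leb_pi n) \<times> A) (x, z) \<partial>leb_pi k)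
      = ?F x * output_prob \<alpha> \<gamma> n k A x" .
  qed
  also have "\<dots> = (\<integral>\<^sup>+x. output_prob \<alpha> \<gamma> n k A x \<partial>PiM {..<n} (\<lambda>_. law))"
    unfolding law_pi_eq
  proof (rule nn_integral_density[symmetric, OF F])
    have "(\<lambda>xz. ?w (fst xz) (snd xz) * indicator A (snd xz)) \<in> borel_measurable (leb_pi n \<Otimes>\<^sub>M leb_pi k)"
      by measurable
    then have "(\<lambda>x. \<integral>\<^sup>+z. ?w x z * indicator A z \<partial>leb_pi k) \<in> borel_measurable (leb_pi n)"
      by (intro Q.borel_measurable_nn_integral) (simp add: case_prod_beta')
    then show "output_prob \<alpha> \<gamma> n k A \<in> borel_measurable (leb_pi n)"
      unfolding output_prob_def[abs_def] by measurable
  qed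
  finally show ?thesis .
qed

lemma loss_measurable [measurable]: "loss m N \<in> borel_measurable (leb_pi N)"
proof -
  have [measurable]: "(\<lambda>\<omega>. proj_est m N (fst \<omega>) (snd \<omega>)) \<in> borel_measurable (leb_pi N \<Otimes>\<^sub>M borel)"
    using proj_est_measurable_pair[OF measurable_ident] by (simp add: case_prod_beta')
  show ?thesis
    unfolding loss_def[abs_def] by (rule integral_unit_measurable) (unfold case_prod_beta', measurable)
qed

end

subsection \<open>Comparing the score with the loss\<close>

lemma emp_coeff_lipschitz:
  assumes "\<And>i. i < N \<Longrightarrow> \<bar>w i - z i\<bar> \<le> d" "0 \<le> d"
  shows "\<bar>emp_coeff N w j - emp_coeff N z j\<bar> \<le> sqrt 2 * pi * real j * d"
proof (cases "j = 0 \<or> N = 0")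
  case True
  then show ?thesis using assms by (auto simp: emp_coeff_def)
next
  case False
  have "\<bar>\<Sum>i<N. psi j (w i) - psi j (z i)\<bar> \<le> (\<Sum>i<N. \<bar>psi j (w i) - psi j (z i)\<bar>)"
    by (rule sum_abs)
  also have "\<dots> \<le> (\<Sum>i<N. sqrt 2 * pi * real j * d)"
  proof (rule sum_mono)
    fix i assume "i \<in> {..<N}"
    then show "\<bar>psi j (w i) - psi j (z i)\<bar> \<le> sqrt 2 * pi * real j * d"
      by (intro order.trans[OF psi_lipschitz] mult_left_mono assms(1)) auto
  qed
  finally have "\<bar>\<Sum>i<N. psi j (w i) - psi j (z i)\<bar> \<le> real N * (sqrt 2 * pi * real j * d)" by simp
  then show ?thesis using False
    by (simp add: emp_coeff_def sum_subtractf abs_divide divide_le_eq mult_ac flip: diff_divide_distrib)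
qed

text \<open>By Parseval only coefficients matter. Index 0 does not move, and each of the other
  \<open>m\<close> moves by at most sqrt 2 * pi * m * d.\<close>

lemma proj_est_perturbation:
  assumes "\<And>i. i < N \<Longrightarrow> \<bar>w i - z i\<bar> \<le> d" "0 \<le> d"
  shows "(LINT t|unit_leb. (proj_est m N w t - proj_est m N z t)\<^sup>2) \<le> 2 * pi\<^sup>2 * real m ^ 3 * d\<^sup>2"
proof -
  have "(\<Sum>j\<le>m. (emp_coeff N w j - emp_coeff N z j)\<^sup>2) = (\<Sum>j=1..m. (emp_coeff N w j - emp_coeff N z j)\<^sup>2)"
    by (rule sum.mono_neutral_right) (auto simp: emp_coeff_def)
  also have "\<dots> \<le> (\<Sum>j=1..m. (sqrt 2 * pi * real m * d)\<^sup>2)"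
  proof (rule sum_mono)
    fix j assume j: "j \<in> {1..m}"
    have "\<bar>emp_coeff N w j - emp_coeff N z j\<bar> \<le> sqrt 2 * pi * real j * d"
      using assms by (rule emp_coeff_lipschitz)
    also have "\<dots> \<le> sqrt 2 * pi * real m * d"
      using j assms(2) by (intro mult_right_mono mult_left_mono) auto
    finally have "\<bar>emp_coeff N w j - emp_coeff N z j\<bar>\<^sup>2 \<le> (sqrt 2 * pi * real m * d)\<^sup>2"
      by (rule power_mono) simp
    then show "(emp_coeff N w j - emp_coeff N z j)\<^sup>2 \<le> (sqrt 2 * pi * real m * d)\<^sup>2" by simp
  qed
  also have "\<dots> = 2 * pi\<^sup>2 * real m ^ 3 * d\<^sup>2"
    by (simp add: power_mult_distrib power2_eq_square power3_eq_cube)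
  finally show ?thesis by (simp add: integral_proj_est_diff_square)
qed

lemma xi_square:
  "(xi \<gamma> n k x z)\<^sup>2 = (LINT t|unit_leb. (p_hat \<gamma> n x t - p_star \<gamma> k z t)\<^sup>2)"
  by (simp add: xi_def set_integral_unit)

lemma xi_nonneg: "0 \<le> xi \<gamma> n k x z"
  by (simp add: xi_def set_integral_unit)

context sobolev_density
begin

lemma integrable_loss: "integrable unit_leb (\<lambda>t. (dens t - proj_est m N x t)\<^sup>2)"
  by (rule integrable_sq_diff_proj_est[OF _ abs_dens_le]) simp

lemma integrable_proj_est_diff: "integrable unit_leb (\<lambda>t. (proj_est m N x t - proj_est m' N' y t)\<^sup>2)"
  by (rule integrable_sq_diff_proj_est[OF _ abs_proj_est_le]) simp

text \<open>Triangle inequality through \<open>p_hat\<close>: with an accurate \<open>p_hat\<close>,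
  a large loss of the output forces a large score.\<close>

lemma loss_le_xi:
  "loss (trunc_level \<gamma> k) k z \<le> 2 * loss (trunc_level \<gamma> n) n x + 2 * (xi \<gamma> n k x z)\<^sup>2"
  unfolding xi_square loss_def p_hat_def p_star_def
  by (rule integral_square_triangle[OF integrable_loss integrable_proj_est_diff])

text \<open>Triangle inequality through \<open>dens\<close>: two accurate estimators have a small
  score.\<close>

lemma xi_le_loss:
  "(xi \<gamma> n k x z)\<^sup>2 \<le> 2 * loss (trunc_level \<gamma> n) n x + 2 * loss (trunc_level \<gamma> k) k z"
  using integral_square_triangle[of "proj_est (trunc_level \<gamma> n) n x" dens "proj_est (trunc_level \<gamma> k) k z"]
    integrable_loss[of "trunc_level \<gamma> n" n x] integrable_loss[of "trunc_level \<gamma> k" k z]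
  unfolding xi_square loss_def p_hat_def p_star_def by (simp add: power2_commute[of _ "dens _"])

lemma loss_perturbation:
  assumes "\<And>i. i < N \<Longrightarrow> \<bar>w i - z i\<bar> \<le> d" "0 \<le> d"
  shows "loss m N w \<le> 2 * loss m N z + 4 * pi\<^sup>2 * real m ^ 3 * d\<^sup>2"
proof -
  have "loss m N w \<le> 2 * loss m N z + 2 * (LINT t|unit_leb. (proj_est m N z t - proj_est m N w t)\<^sup>2)"
    unfolding loss_def by (rule integral_square_triangle[OF integrable_loss integrable_proj_est_diff])
  also have "(LINT t|unit_leb. (proj_est m N z t - proj_est m N w t)\<^sup>2) \<le> 2 * pi\<^sup>2 * real m ^ 3 * d\<^sup>2"
    using proj_est_perturbation[of N w z d m] assms by (simp add: power2_commute[of "proj_est m N z _"])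
  finally show ?thesis by simp
qed

text \<open>The first term bounds the probability of data with an inaccurate \<open>p_hat\<close>.
  For all other data, outputs in \<open>A\<close> score at least twice as much as a box of volume at
  least n^(-k), which gives the second term.\<close>

lemma emeasure_joint_law_loss_gt_le:
  assumes n: "n > 0" and k: "k > 0" and r: "r > 0" and K: "K \<ge> 0" and \<alpha>: "\<alpha> \<ge> 0" and \<Delta>: "Delta \<gamma> n > 0"
    and risk: "risk_bound (trunc_level \<gamma> k) k \<le> K * r"
    and perturb: "4 * pi\<^sup>2 * real (trunc_level \<gamma> k) ^ 3 / (real n)\<^sup>2 \<le> 2 * r"
  defines "A \<equiv> {z \<in> space (leb_pi k). loss (trunc_level \<gamma> k) k z > (50 + 32 * K) * r}"
  shows "emeasure (joint_law \<alpha> \<gamma> dens n k) (space (leb_pi n) \<times> A)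
    \<le> ennreal (risk_bound (trunc_level \<gamma> n) n / r)
      + ennreal (exp (- \<alpha> * (sqrt (6 + 4 * K) * sqrt r) / (2 * Delta \<gamma> n)) * real n ^ k)"
proof -
  \<comment> \<open>\<open>s\<close> bounds the score on the box: 2 r + 2 (2 K r + 2 r) = (6 + 4 K)
    r. The threshold 50 + 32 K equals 2 + 8 (6 + 4 K), so a larger loss forces a squared score above
    4 s^2.\<close>
  define s where "s = sqrt (6 + 4 * K) * sqrt r"
  have s: "s\<^sup>2 = (6 + 4 * K) * r" "0 \<le> s"
    using K r by (simp_all add: s_def power_mult_distrib)
  let ?q = "exp (- \<alpha> * s / (2 * Delta \<gamma> n)) * real n ^ k"
  let ?P = "PiM {..<n} (\<lambda>_. law)"
  let ?L = "loss_bound (trunc_level \<gamma> n) n"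
  interpret P: prob_space ?P by (rule prob_space_PiM) (rule prob_space_law)
  have [measurable]: "A \<in> sets (leb_pi k)" unfolding A_def by measurable
  obtain z where z: "\<And>i. i < k \<Longrightarrow> z i \<in> {0..1}" "loss (trunc_level \<gamma> k) k z \<le> risk_bound (trunc_level \<gamma> k) k"
    using exists_sample_loss_le[OF k] by blast
  obtain B where B: "B \<in> sets (leb_pi k)" "B \<subseteq> unit_cube k" "ennreal ((1 / real n) ^ k) \<le> emeasure (leb_pi k) B"
    "\<And>w i. w \<in> B \<Longrightarrow> i < k \<Longrightarrow> \<bar>w i - z i\<bar> \<le> 1 / real n"
    using exists_small_box[of k z "1 / real n"] z(1) n by auto
  have B_loss: "loss (trunc_level \<gamma> k) k w \<le> 2 * K * r + 2 * r" if "w \<in> B" for w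
    using loss_perturbation[of k w z "1 / real n" "trunc_level \<gamma> k"] B(4)[OF that] z(2) risk perturb
    by (simp add: power_divide)
  have good: "output_prob \<alpha> \<gamma> n k A x \<le> ennreal ?q" if x: "x \<in> space (leb_pi n)" and Lx: "?L x < r" for x
  proof -
    have loss_x: "loss (trunc_level \<gamma> n) n x \<le> r"
      using loss_le_loss_bound[of "trunc_level \<gamma> n" n x] Lx by linarith
    \<comment> \<open>The scores are separated by the levels 2 s and s, and \<open>v\<close> is the
      box volume bound n^(-k).\<close>
    have "output_prob \<alpha> \<gamma> n k A x \<le> ennreal (exp (- \<alpha> * (2 * s - s) / (2 * Delta \<gamma> n)) / (1 / real n) ^ k)"
    proof (rule output_prob_le)
      fix w assume "w \<in> A"
      then have "(50 + 32 * K) * r < 2 * r + 2 * (xi \<gamma> n k x w)\<^sup>2"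
        using loss_le_xi[of k w n x] loss_x by (auto simp: A_def)
      then have "(2 * s)\<^sup>2 \<le> (xi \<gamma> n k x w)\<^sup>2"
        using s(1) by (simp add: power_mult_distrib algebra_simps)
      then show "2 * s \<le> xi \<gamma> n k x w" by (rule power2_le_imp_le[OF _ xi_nonneg])
    next
      fix w assume "w \<in> B"
      then have "(xi \<gamma> n k x w)\<^sup>2 \<le> s\<^sup>2"
        using xi_le_loss[of n k x w] B_loss[of w] loss_x s(1) by (simp add: algebra_simps)
      then show "xi \<gamma> n k x w \<le> s" using s(2) by (rule power2_le_imp_le)
    qed (use x B n \<alpha> \<Delta> in auto)
    then show ?thesis using n by (simp add: power_divide)
  qed
  let ?G = "{x \<in> space ?P. r \<le> ?L x}"
  have space_P: "space ?P = space (leb_pi n)" by (simp add: space_PiM)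
  have [measurable]: "?L \<in> borel_measurable ?P"
    using integrable_loss_bound[OF n] by (rule borel_measurable_integrable)
  have "emeasure (joint_law \<alpha> \<gamma> dens n k) (space (leb_pi n) \<times> A)
    = (\<integral>\<^sup>+x. output_prob \<alpha> \<gamma> n k A x \<partial>?P)"
    by (rule emeasure_joint_law) measurable
  \<comment> \<open>Bad data are charged the trivial bound 1 and good data the exponential bound;
    Markov's inequality then controls \<open>?G\<close>.\<close>
  also have "\<dots> \<le> (\<integral>\<^sup>+x. indicator ?G x + ennreal ?q \<partial>?P)"
  proof (rule nn_integral_mono)
    fix x assume x: "x \<in> space ?P"
    show "output_prob \<alpha> \<gamma> n k A x \<le> indicator ?G x + ennreal ?q"
    proof (cases "?L x < r")
      case True
      then show ?thesis using good[of x] x by (simp add: space_P indicator_def)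
    next
      case False
      then have "output_prob \<alpha> \<gamma> n k A x \<le> indicator ?G x"
        using x output_prob_le_1[of A k x n] by (simp add: space_P)
      then show ?thesis by (rule add_increasing2[rotated]) simp
    qed
  qed
  also have "\<dots> = emeasure ?P ?G + ennreal ?q"
    by (subst nn_integral_add) (auto simp: P.emeasure_space_1)
  also have "\<dots> \<le> ennreal (risk_bound (trunc_level \<gamma> n) n / r) + ennreal ?q"
    using prob_loss_bound_gt_le[OF n r] by (intro add_right_mono)
  finally show ?thesis by (simp add: s_def)
qed

end

subsection \<open>Rates\<close>

lemma trunc_level_le: "real (trunc_level \<gamma> n) \<le> real n powr (1 / (2 * \<gamma> + 1))"
  by (simp add: trunc_level_def)

lemma Suc_trunc_level_ge: "real n powr (1 / (2 * \<gamma> + 1)) \<le> real (Suc (trunc_level \<gamma> n))"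
  unfolding trunc_level_def by linarith

lemma trunc_level_pos: "n > 0 \<Longrightarrow> \<gamma> > 0 \<Longrightarrow> trunc_level \<gamma> n > 0"
  by (simp add: trunc_level_def le_nat_floor ge_one_powr_ge_zero)

text \<open>The exponent 3 / (2 \<gamma> + 1) is at most 1. Applied at \<open>k\<close>, it keeps
  the effect of moving sample points by 1 / n of order k / n^2.\<close>

lemma trunc_level_cubed_le:
  assumes "\<gamma> \<ge> 1" "n > 0"
  shows "real (trunc_level \<gamma> n) ^ 3 \<le> real n"
proof -
  have "real (trunc_level \<gamma> n) ^ 3 \<le> (real n powr (1 / (2 * \<gamma> + 1))) ^ 3"
    by (intro power_mono trunc_level_le) simp
  also have "\<dots> = real n powr (3 * (1 / (2 * \<gamma> + 1)))"
    using assms by (simp add: powr_power mult.commute)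
  also have "\<dots> \<le> real n powr 1"
    using assms by (intro powr_mono) (auto simp: field_simps)
  finally show ?thesis by simp
qed

lemma Delta_le:
  "Delta \<gamma> n \<le> 4 * (real n powr (1 / (2 * \<gamma> + 1)) / real n)"
  using trunc_level_le[of \<gamma> n] by (simp add: Delta_def c0_def divide_right_mono)

lemma Delta_pos: "n > 0 \<Longrightarrow> \<gamma> > 0 \<Longrightarrow> Delta \<gamma> n > 0"
  using trunc_level_pos[of n \<gamma>] by (simp add: Delta_def c0_def)

text \<open>The truncation level balances both terms: squared bias and variance each have order
  N^(-2\<gamma>/(2\<gamma>+1)).\<close>

lemma (in sobolev_density) risk_bound_trunc_level_le:
  assumes N: "N > 0"
  shows "risk_bound (trunc_level \<gamma> N) N \<le> (2 * C\<^sup>2 + 4) * real N powr (- 2 * \<gamma> / (2 * \<gamma> + 1))"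
proof -
  let ?m = "trunc_level \<gamma> N"
  have g: "\<gamma> > 0" using gamma_gt_half by simp
  have "real (Suc ?m) powr (- 2 * \<gamma>) \<le> (real N powr (1 / (2 * \<gamma> + 1))) powr (- 2 * \<gamma>)"
    using N g Suc_trunc_level_ge by (intro powr_mono2') auto
  also have "\<dots> = real N powr (- 2 * \<gamma> / (2 * \<gamma> + 1))"
    by (simp add: powr_powr)
  finally have 1: "2 * C\<^sup>2 * real (Suc ?m) powr (- 2 * \<gamma>) \<le> 2 * C\<^sup>2 * real N powr (- 2 * \<gamma> / (2 * \<gamma> + 1))"
    by (intro mult_left_mono) auto
  have "real ?m / real N \<le> real N powr (1 / (2 * \<gamma> + 1)) / real N powr 1"
    using trunc_level_le[of \<gamma> N] by (simp add: divide_right_mono)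
  also have "\<dots> = real N powr (1 / (2 * \<gamma> + 1) - 1)"
    by (rule powr_diff[symmetric])
  also have "1 / (2 * \<gamma> + 1) - 1 = - 2 * \<gamma> / (2 * \<gamma> + 1)"
    using g by (simp add: field_simps)
  finally have "4 * real ?m / real N \<le> 4 * real N powr (- 2 * \<gamma> / (2 * \<gamma> + 1))" by simp
  with 1 show ?thesis unfolding risk_bound_def distrib_right by (rule add_mono)
qed

lemma exp_mechanism_tail_tendsto:
  fixes c d e :: real
  assumes "e > 1 / 2" "d > 0"
  shows "(\<lambda>n. exp (c * sqrt (real n) * ln (real n) - d * real n powr e)) \<longlonglongrightarrow> 0"
proof -
  have "((\<lambda>x::real. exp (c * sqrt x * ln x - d * x powr e)) \<longlongrightarrow> 0) at_top"
    using assms by real_asymp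
  then show ?thesis by (rule filterlim_compose[OF _ filterlim_real_sequentially])
qed

text \<open>Write n^k = exp(k ln n) and bound \<open>Delta\<close> from above. The constant 8 is 2
  from the exponent of the mechanism times 4 from \<open>Delta_le\<close>.\<close>

lemma exp_mechanism_exponent_le:
  assumes n: "n > 0" and g: "\<gamma> > 0" and d: "d \<ge> 0" and k: "real k \<le> c * sqrt (real n)"
  shows "exp (- d * sqrt (real n powr (- \<gamma> / (2 * \<gamma> + 1))) / (2 * Delta \<gamma> n)) * real n ^ k
    \<le> exp (c * sqrt (real n) * ln (real n) - d / 8 * real n powr (3 / 2 * (\<gamma> / (2 * \<gamma> + 1))))"
proof -
  let ?r = "real n powr (- \<gamma> / (2 * \<gamma> + 1))"
  have "d / 8 * real n powr (3 / 2 * (\<gamma> / (2 * \<gamma> + 1)))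
      = d * sqrt ?r / (2 * (4 * (real n powr (1 / (2 * \<gamma> + 1)) / real n)))"
  proof -
    \<comment> \<open>With a = \<gamma> / (2\<gamma> + 1), the exponent of sqrt r / Delta is -a/2 +
      1 - (1 - 2a) = 3a/2.\<close>
    have "1 / (2 * \<gamma> + 1) = 1 - 2 * (\<gamma> / (2 * \<gamma> + 1))"
      using g by (simp add: field_simps)
    then have "3 / 2 * (\<gamma> / (2 * \<gamma> + 1)) = 1 / 2 * (- \<gamma> / (2 * \<gamma> + 1)) + 1 - 1 / (2 * \<gamma> + 1)"
      unfolding minus_divide_left[symmetric] by linarith
    then have "real n powr (3 / 2 * (\<gamma> / (2 * \<gamma> + 1))) = sqrt ?r * real n / real n powr (1 / (2 * \<gamma> + 1))"
      using n by (simp only: powr_diff powr_add) (simp add: powr_powr flip: powr_half_sqrt)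
    then show ?thesis by simp
  qed
  also have "\<dots> \<le> d * sqrt ?r / (2 * Delta \<gamma> n)"
    using Delta_le[of \<gamma> n] Delta_pos[OF n g] d n by (intro divide_left_mono mult_pos_pos divide_pos_pos) auto
  finally have 1: "d / 8 * real n powr (3 / 2 * (\<gamma> / (2 * \<gamma> + 1))) \<le> d * sqrt ?r / (2 * Delta \<gamma> n)" .
  have "real k * ln (real n) \<le> c * sqrt (real n) * ln (real n)"
    using k n by (intro mult_right_mono) auto
  moreover have "real n ^ k = exp (real k * ln (real n))"
    using n by (simp add: exp_of_nat_mult)
  ultimately show ?thesis using 1 by (simp flip: exp_add)
qed

text \<open>With y = k and x = n, the rate k^(-2a) becomes n^(-a): the square root in the size of
  \<open>k\<close> halves the exponent.\<close>

lemma powr_le_of_sqrt_le: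
  assumes "c > 0" "x > 0" "c * sqrt x \<le> y" "a \<ge> 0"
  shows "y powr (- 2 * a) \<le> c powr (- 2 * a) * x powr (- a)"
proof -
  have "y powr (- 2 * a) \<le> (c * sqrt x) powr (- 2 * a)"
    using assms by (intro powr_mono2') auto
  also have "\<dots> = c powr (- 2 * a) * x powr (- a)"
    using assms by (simp add: powr_mult powr_powr flip: powr_half_sqrt)
  finally show ?thesis .
qed

section \<open>Assembling the rate\<close>

context sobolev_density
begin

lemma synthetic_loss_rate:
  fixes k :: "nat \<Rightarrow> nat"
  assumes g: "\<gamma> > 1" and \<alpha>: "\<alpha> > 0" and k_Theta: "(\<lambda>n. real (k n)) \<in> \<Theta>(\<lambda>n. sqrt (real n))"
  obtains M :: real where "M > 0" and "\<And>\<epsilon>. \<epsilon> > 0 \<Longrightarrow> eventually (\<lambda>n.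
    emeasure (joint_law \<alpha> \<gamma> dens n (k n)) (space (leb_pi n) \<times>
      {z \<in> space (leb_pi (k n)). loss (trunc_level \<gamma> (k n)) (k n) z > M * real n powr (- \<gamma> / (2 * \<gamma> + 1))})
    < ennreal \<epsilon>) sequentially"
proof -
  define a where "a = \<gamma> / (2 * \<gamma> + 1)"
  \<comment> \<open>The lower bound 1/3 restates \<gamma> > 1 and makes 3a/2 exceed 1/2.\<close>
  have a: "a > 1 / 3" "a < 1 / 2" using g by (simp_all add: a_def field_simps)
  have a_eq: "- \<gamma> / (2 * \<gamma> + 1) = - a" "- 2 * \<gamma> / (2 * \<gamma> + 1) = - 2 * a" by (simp_all add: a_def)
  define Q where "Q = 2 * C\<^sup>2 + 4"
  have Q: "Q > 0" by (simp add: Q_def add_nonneg_pos)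
  obtain c1 c2 where c: "c1 > 0" "c2 > 0"
    and lo: "eventually (\<lambda>n. c1 * sqrt (real n) \<le> real (k n)) sequentially"
    and hi: "eventually (\<lambda>n. real (k n) \<le> c2 * sqrt (real n)) sequentially"
  proof -
    from k_Theta have O: "(\<lambda>n. real (k n)) \<in> O(\<lambda>n. sqrt (real n))"
      and Om: "(\<lambda>n. real (k n)) \<in> \<Omega>(\<lambda>n. sqrt (real n))"
      by (auto simp: bigtheta_def)
    obtain c2 where "c2 > 0" "eventually (\<lambda>n. norm (real (k n)) \<le> c2 * norm (sqrt (real n))) sequentially"
      using O by (elim landau_o.bigE)
    moreover obtain c1 where "c1 > 0" "eventually (\<lambda>n. norm (real (k n)) \<ge> c1 * norm (sqrt (real n))) sequentially"
      using Om by (elim landau_omega.bigE)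
    ultimately show thesis by (intro that[of c1 c2]) auto
  qed
  define K where "K = Q * c1 powr (- 2 * a)"
  have K: "K > 0" using Q c by (simp add: K_def)
  define d where "d = \<alpha> * sqrt (6 + 4 * K)"
  have d: "d > 0" using \<alpha> K by (simp add: d_def)
  \<comment> \<open>The two summands bound the probability of inaccurate data and the conditional
    probability of a bad output.\<close>
  define u where "u n = Q * real n powr (- a) + exp (c2 * sqrt (real n) * ln (real n) - d / 8 * real n powr (3 / 2 * a))" for n :: nat
  have u: "u \<longlonglongrightarrow> 0"
  proof -
    have "((\<lambda>x::real. Q * x powr (- a)) \<longlongrightarrow> 0) at_top" using a by real_asymp
    then have "(\<lambda>n. Q * real n powr (- a)) \<longlonglongrightarrow> 0"
      by (rule filterlim_compose[OF _ filterlim_real_sequentially])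
    then show ?thesis
      unfolding u_def using tendsto_add[OF _ exp_mechanism_tail_tendsto[of "3 / 2 * a" "d / 8" c2]] a d by fastforce
  qed
  \<comment> \<open>The left side is of order n^(-3/2), which is negligible against n^(-a).\<close>
  have perturb: "eventually (\<lambda>n. 4 * pi\<^sup>2 * (c2 * sqrt (real n)) / (real n)\<^sup>2 \<le> 2 * real n powr (- a)) sequentially"
  proof -
    have "eventually (\<lambda>x::real. 4 * pi\<^sup>2 * (c2 * sqrt x) / x\<^sup>2 \<le> 2 * x powr (- a)) at_top"
      using a c by real_asymp
    then show ?thesis by (rule eventually_compose_filterlim[OF _ filterlim_real_sequentially])
  qed
  have main: "eventually (\<lambda>n.
    emeasure (joint_law \<alpha> \<gamma> dens n (k n)) (space (leb_pi n) \<times>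
      {z \<in> space (leb_pi (k n)). loss (trunc_level \<gamma> (k n)) (k n) z > (50 + 32 * K) * real n powr (- a)})
    \<le> ennreal (u n)) sequentially"
    using lo hi perturb eventually_gt_at_top[of 0]
  proof eventually_elim
    case (elim n)
    let ?r = "real n powr (- a)"
    have n: "n > 0" and r: "?r > 0" using elim by auto
    have "0 < c1 * sqrt (real n)" using c n by simp
    with elim(1) have k: "k n > 0" by linarith
    have "risk_bound (trunc_level \<gamma> (k n)) (k n) \<le> Q * real (k n) powr (- 2 * a)"
      using risk_bound_trunc_level_le[OF k] by (simp only: a_eq Q_def)
    also have "\<dots> \<le> Q * (c1 powr (- 2 * a) * ?r)"
      using Q c n a elim(1) by (intro mult_left_mono powr_le_of_sqrt_le) auto
    finally have risk: "risk_bound (trunc_level \<gamma> (k n)) (k n) \<le> K * ?r" by (simp add: K_def mult.assoc)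
    have "4 * pi\<^sup>2 * real (trunc_level \<gamma> (k n)) ^ 3 / (real n)\<^sup>2 \<le> 4 * pi\<^sup>2 * (c2 * sqrt (real n)) / (real n)\<^sup>2"
      using order.trans[OF trunc_level_cubed_le elim(2)] g k
      by (intro divide_right_mono mult_left_mono) auto
    also note elim(3)
    finally have pert: "4 * pi\<^sup>2 * real (trunc_level \<gamma> (k n)) ^ 3 / (real n)\<^sup>2 \<le> 2 * ?r" .
    \<comment> \<open>The risk at sample size \<open>n\<close> has order n^(-2a), the square of the
      threshold n^(-a), so the Markov quotient still tends to 0.\<close>
    have "risk_bound (trunc_level \<gamma> n) n / ?r \<le> Q * real n powr (- 2 * a) / ?r"
      using risk_bound_trunc_level_le[OF n] r by (simp only: a_eq Q_def) (simp add: divide_right_mono)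
    also have "\<dots> = Q * real n powr (- a)"
      using powr_diff[of "real n" "- 2 * a" "- a"]
      by (simp add: times_divide_eq_right[symmetric] del: times_divide_eq_right)
    finally have 1: "risk_bound (trunc_level \<gamma> n) n / ?r \<le> Q * real n powr (- a)" .
    have 2: "exp (- \<alpha> * (sqrt (6 + 4 * K) * sqrt ?r) / (2 * Delta \<gamma> n)) * real n ^ k n
      \<le> exp (c2 * sqrt (real n) * ln (real n) - d / 8 * real n powr (3 / 2 * a))"
      using exp_mechanism_exponent_le[of n \<gamma> d "k n" c2] n g d elim(2)
      by (simp add: a_eq a_def[symmetric] d_def mult.assoc)
    have "emeasure (joint_law \<alpha> \<gamma> dens n (k n)) (space (leb_pi n) \<times>
      {z \<in> space (leb_pi (k n)). loss (trunc_level \<gamma> (k n)) (k n) z > (50 + 32 * K) * ?r})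
      \<le> ennreal (risk_bound (trunc_level \<gamma> n) n / ?r)
      + ennreal (exp (- \<alpha> * (sqrt (6 + 4 * K) * sqrt ?r) / (2 * Delta \<gamma> n)) * real n ^ k n)"
      using n k r K \<alpha> g risk pert Delta_pos[of n \<gamma>] by (intro emeasure_joint_law_loss_gt_le) auto
    also have "\<dots> \<le> ennreal (Q * real n powr (- a)) + ennreal (exp (c2 * sqrt (real n) * ln (real n) - d / 8 * real n powr (3 / 2 * a)))"
      using 1 2 by (intro add_mono ennreal_leI)
    also have "\<dots> = ennreal (u n)" using Q by (simp add: u_def)
    finally show ?case .
  qed
  show thesis
  proof (rule that[of "50 + 32 * K"])
    show "50 + 32 * K > 0" using K by simp
    fix \<epsilon> :: real assume "\<epsilon> > 0"
    then have "eventually (\<lambda>n. u n < \<epsilon>) sequentially" by (rule order_tendstoD(2)[OF u])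
    with main show "eventually (\<lambda>n.
      emeasure (joint_law \<alpha> \<gamma> dens n (k n)) (space (leb_pi n) \<times>
        {z \<in> space (leb_pi (k n)). loss (trunc_level \<gamma> (k n)) (k n) z > (50 + 32 * K) * real n powr (- \<gamma> / (2 * \<gamma> + 1))})
      < ennreal \<epsilon>) sequentially"
    proof eventually_elim
      case (elim n)
      then show ?case using \<open>\<epsilon> > 0\<close> unfolding a_eq by (meson ennreal_lessI le_less_trans)
    qed
  qed
qed

end

section \<open>Transfer to the Sobolev class\<close>

lemma sobolev_densities_cases:
  assumes "p \<in> sobolev_densities \<gamma> C" "\<gamma> > 1 / 2"
  obtains b where "sobolev_density \<gamma> C b" "\<And>t. t \<in> {0..1} \<Longrightarrow> p t = sobolev_density.dens b t"
proof -
  obtain \<beta> where \<beta>: "\<beta> \<in> sobolev_coeffs \<gamma> C"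
    "\<And>t. t \<in> {0..1} \<Longrightarrow> p t = 1 + (\<Sum>j. \<beta> (Suc j) * psi (Suc j) t) \<and> p t \<ge> 0"
    using assms(1) unfolding sobolev_densities_def by blast
  define b where "b j = (if j = 0 then 1 else \<beta> j)" for j
  interpret sobolev_density \<gamma> C b
    using \<beta> assms(2) by unfold_locales (force simp: b_def sobolev_coeffs_def)+
  show thesis
    using \<beta>(2) by (intro that[of b]) (unfold_locales, simp add: dens_eq b_def)
qed

theorem mainTheorem12:
  fixes \<gamma> C \<alpha> :: real and p :: "real \<Rightarrow> real" and k :: "nat \<Rightarrow> nat"
  assumes "\<gamma> > 1" and "C > 0" and "\<alpha> > 0"
    and "p \<in> sobolev_densities \<gamma> C"
    and "(\<lambda>n. real (k n)) \<in> \<Theta>(\<lambda>n. sqrt (real n))"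
  shows "\<forall>\<epsilon>>0. \<exists>M>0. \<exists>N. \<forall>n\<ge>N.
     (let E = {xz \<in> space (joint_law \<alpha> \<gamma> p n (k n)).
                 (LINT t:{0..1}|lborel. (p t - p_star \<gamma> (k n) (snd xz) t)\<^sup>2)
                   > M * real n powr (- \<gamma> / (2 * \<gamma> + 1))}
      in E \<in> sets (joint_law \<alpha> \<gamma> p n (k n)) \<and>
         emeasure (joint_law \<alpha> \<gamma> p n (k n)) E < ennreal \<epsilon>)"
proof -
  obtain b where b: "sobolev_density \<gamma> C b" "\<And>t. t \<in> {0..1} \<Longrightarrow> p t = sobolev_density.dens b t"
    using sobolev_densities_cases[OF assms(4)] assms(1) by auto
  interpret sobolev_density \<gamma> C b by fact
  have law_eq: "joint_law \<alpha> \<gamma> p n l = joint_law \<alpha> \<gamma> dens n l" for n l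
    by (rule joint_law_cong) (rule b(2))
  have loss_eq: "(LINT t:{0..1}|lborel. (p t - p_star \<gamma> l z t)\<^sup>2) = loss (trunc_level \<gamma> l) l z" for l z
    unfolding set_integral_unit loss_def p_star_def by (rule Bochner_Integration.integral_cong) (simp_all add: b(2))
  define A where "A s l = {z \<in> space (leb_pi l). loss (trunc_level \<gamma> l) l z > s}" for s l
  have A [measurable]: "A s l \<in> sets (leb_pi l)" for s l unfolding A_def by measurable
  have sets_joint: "sets (joint_law \<alpha> \<gamma> dens n l) = sets (leb_pi n \<Otimes>\<^sub>M leb_pi l)" for n l
    by (simp add: joint_law_def)
  \<comment> \<open>The loss depends on the output alone, so the event is a measurable rectangle
    with no constraint on the data.\<close>
  have E_eq: "{xz \<in> space (joint_law \<alpha> \<gamma> dens n l). loss (trunc_level \<gamma> l) l (snd xz) > s} = space (leb_pi n) \<times> A s l"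
    for n l s
    by (auto simp: joint_law_def A_def space_pair_measure)
  have E_sets: "space (leb_pi n) \<times> A s l \<in> sets (joint_law \<alpha> \<gamma> dens n l)" for n s l
    unfolding sets_joint by measurable
  obtain M where M: "M > 0" "\<And>\<epsilon>. \<epsilon> > 0 \<Longrightarrow> eventually (\<lambda>n.
    emeasure (joint_law \<alpha> \<gamma> dens n (k n)) (space (leb_pi n) \<times> A (M * real n powr (- \<gamma> / (2 * \<gamma> + 1))) (k n))
    < ennreal \<epsilon>) sequentially"
    using synthetic_loss_rate[OF assms(1,3,5)] unfolding A_def by blast
  show ?thesis
    unfolding law_eq loss_eq Let_def E_eq
  \<comment> \<open>One constant \<open>M\<close> serves every \<epsilon>; only the threshold for
    \<open>n\<close> depends on it.\<close>
  proof (intro allI impI exI[of _ M] conjI M(1))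
    fix \<epsilon> :: real assume "\<epsilon> > 0"
    from M(2)[OF this] obtain N where N: "\<And>n. n \<ge> N \<Longrightarrow>
      emeasure (joint_law \<alpha> \<gamma> dens n (k n)) (space (leb_pi n) \<times> A (M * real n powr (- \<gamma> / (2 * \<gamma> + 1))) (k n))
      < ennreal \<epsilon>"
      unfolding eventually_sequentially by auto
    show "\<exists>N. \<forall>n\<ge>N. space (leb_pi n) \<times> A (M * real n powr (- \<gamma> / (2 * \<gamma> + 1))) (k n)
          \<in> sets (joint_law \<alpha> \<gamma> dens n (k n)) \<and>
        emeasure (joint_law \<alpha> \<gamma> dens n (k n)) (space (leb_pi n) \<times> A (M * real n powr (- \<gamma> / (2 * \<gamma> + 1))) (k n))
          < ennreal \<epsilon>"
      by (intro exI[of _ N] allI impI conjI E_sets N)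
  qed
qed

end
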